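(* Let $(M,F)$ be a Finsler manifold and $f:M\to M$ a diffeomorphism. Then $d_F(f(x),f(y))=d_F(x,y)$ for every $x,y\in M$ if and only if $F(f(x),df_x(v))=F(x,v)$ for every $(x,v)\in TM$.
   Context: Manifolds are Hausdorff with countable basis. A Finsler metric ($C^0$-Finsler) on a differentiable manifold $M$ is a continuous function $F:TM\to\mathbb R$ whose restriction $F(p,\cdot)$ to each tangent space $T_pM$ is a norm (no smoothness or strong convexity is required). The distance function of $F$ is $d_F(x,y)=\inf_\gamma\int F(\gamma(t),\gamma'(t))\,dt$, the infimum being over piecewise continuously differentiable paths $\gamma$ connecting $x$ and $y$ ($\inf\emptyset=+\infty$). *)

theory Defs
  imports "HOL-Analysis.Analysis" "HOL-Library.Extended_Nat"
begin

text \<open>For finite-dimensional domains, continuity of every directional derivative is continuity of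
  the derivative, so the recursion below is the usual one.\<close>

primrec Cn_on :: "nat \<Rightarrow> ('a::real_normed_vector \<Rightarrow> 'b::real_normed_vector) \<Rightarrow> 'a set \<Rightarrow> bool" where
  "Cn_on 0 f S \<longleftrightarrow> continuous_on S f"
| "Cn_on (Suc n) f S \<longleftrightarrow> (\<forall>x\<in>S. f differentiable (at x)) \<and>
     (\<forall>v. Cn_on n (\<lambda>x. frechet_derivative f (at x) v) S)"

definition Ck_on :: "enat \<Rightarrow> ('a::real_normed_vector \<Rightarrow> 'b::real_normed_vector) \<Rightarrow> 'a set \<Rightarrow> bool" where
  "Ck_on k f S \<longleftrightarrow> (\<forall>n. enat n \<le> k \<longrightarrow> Cn_on n f S)"

text \<open>The manifold is the whole type \<open>'m\<close>, with its given topology. Charts take values in \<open>'e\<close>,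
  of sort \<open>{banach,heine_borel}\<close>: the Heine--Borel property holds in a normed space exactly when
  it is finite-dimensional. Unlike \<open>euclidean_space\<close>, this sort does not exclude dimension zero.
  The values of a coordinate map outside the domain of its chart are irrelevant.\<close>

type_synonym ('m, 'e) chart = "'m set \<times> ('m \<Rightarrow> 'e)"

abbreviation chart_dom :: "('m, 'e) chart \<Rightarrow> 'm set" where
  "chart_dom \<equiv> fst"

abbreviation chart_map :: "('m, 'e) chart \<Rightarrow> 'm \<Rightarrow> 'e" where
  "chart_map \<equiv> snd"

definition chart_inv :: "('m, 'e) chart \<Rightarrow> 'e \<Rightarrow> 'm" where
  "chart_inv c = inv_into (chart_dom c) (chart_map c)"

definition is_chart :: "('m::topological_space, 'e::{banach,heine_borel}) chart \<Rightarrow> bool" where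
  "is_chart c \<longleftrightarrow> open (chart_dom c) \<and> open (chart_map c ` chart_dom c) \<and>
     homeomorphism (chart_dom c) (chart_map c ` chart_dom c) (chart_map c) (chart_inv c)"

text \<open>The atlas need not be maximal; it determines the differentiable structure.\<close>

definition differentiable_manifold ::
    "enat \<Rightarrow> ('m::{t2_space,second_countable_topology}, 'e::{banach,heine_borel}) chart set \<Rightarrow> bool" where
  "differentiable_manifold k A \<longleftrightarrow>
     (\<forall>c\<in>A. is_chart c) \<and> (\<Union>c\<in>A. chart_dom c) = UNIV \<and>
     (\<forall>c\<in>A. \<forall>d\<in>A. Ck_on k (chart_map d \<circ> chart_inv c) (chart_map c ` (chart_dom c \<inter> chart_dom d)))"

definition Ck_map ::
    "enat \<Rightarrow> ('m::{t2_space,second_countable_topology}, 'e::{banach,heine_borel}) chart set \<Rightarrow> ('m \<Rightarrow> 'm) \<Rightarrow> bool" where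
  "Ck_map k A f \<longleftrightarrow> continuous_on UNIV f \<and>
     (\<forall>c\<in>A. \<forall>d\<in>A. Ck_on k (chart_map d \<circ> f \<circ> chart_inv c)
        (chart_map c ` (chart_dom c \<inter> f -` chart_dom d)))"

definition diffeomorphism ::
    "enat \<Rightarrow> ('m::{t2_space,second_countable_topology}, 'e::{banach,heine_borel}) chart set \<Rightarrow> ('m \<Rightarrow> 'm) \<Rightarrow> bool" where
  "diffeomorphism k A f \<longleftrightarrow> bij f \<and> Ck_map k A f \<and> Ck_map k A (inv f)"

text \<open>A tangent vector at \<open>p\<close> is the family of its coordinate vectors in the charts around \<open>p\<close>,
  related by the derivatives of the transition maps. It is set to 0 at all other arguments, so
  that a tangent vector is determined by its coordinates. The vector space operations of the
  tangent space are pointwise.\<close>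

type_synonym ('m, 'e) tangent_vector = "('m, 'e) chart \<Rightarrow> 'e"

definition tangent_space ::
    "('m, 'e::real_normed_vector) chart set \<Rightarrow> 'm \<Rightarrow> ('m, 'e) tangent_vector set" where
  "tangent_space A p = {v.
     (\<forall>c\<in>A. \<forall>d\<in>A. p \<in> chart_dom c \<longrightarrow> p \<in> chart_dom d \<longrightarrow>
        v d = frechet_derivative (chart_map d \<circ> chart_inv c) (at (chart_map c p)) (v c)) \<and>
     (\<forall>c. \<not> (c \<in> A \<and> p \<in> chart_dom c) \<longrightarrow> v c = 0)}"

lemma tangent_vector_eqI:
  fixes v w :: "('m, 'e::real_normed_vector) tangent_vector"
  assumes v: "v \<in> tangent_space A p" and w: "w \<in> tangent_space A p"
    and c: "c \<in> A" "p \<in> chart_dom c" and eq: "v c = w c"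
  shows "v = w"
proof
  fix d :: "('m, 'e) chart"
  let ?D = "frechet_derivative (chart_map d \<circ> chart_inv c) (at (chart_map c p))"
  show "v d = w d"
  proof (cases "d \<in> A \<and> p \<in> chart_dom d")
    case True
    then have "v d = ?D (v c)" "w d = ?D (w c)"
      using v w c unfolding tangent_space_def by blast+
    then show ?thesis
      by (simp only: eq)
  next
    case False
    then have "v d = 0" "w d = 0"
      using v w unfolding tangent_space_def by blast+
    then show ?thesis
      by (simp only:)
  qed
qed

definition tangent_bundle ::
    "('m, 'e::real_normed_vector) chart set \<Rightarrow> ('m \<times> ('m, 'e) tangent_vector) set" where
  "tangent_bundle A = (SIGMA p:UNIV. tangent_space A p)"

definition bundle_chart_image ::
    "('m, 'e::real_normed_vector) chart \<Rightarrow> ('m \<times> ('m, 'e) tangent_vector) set \<Rightarrow> ('e \<times> 'e) set" where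
  "bundle_chart_image c W = {(chart_map c p, v c) |p v. (p, v) \<in> W \<and> p \<in> chart_dom c}"

text \<open>The topology for which the bundle charts \<open>(p, v) \<mapsto> (chart_map c p, v c)\<close> are
  homeomorphisms from open sets onto open subsets of \<open>'e \<times> 'e\<close>. The definition is applied only to
  sets of charts, whose coordinate maps are injective on their domains.\<close>

definition tangent_topology ::
    "('m, 'e::real_normed_vector) chart set \<Rightarrow> ('m \<times> ('m, 'e) tangent_vector) topology" where
  "tangent_topology A = topology (\<lambda>W. W \<subseteq> tangent_bundle A \<and> (\<forall>c\<in>A. open (bundle_chart_image c W)))"

lemma openin_tangent_topology:
  fixes A :: "('m::topological_space, 'e::{banach,heine_borel}) chart set"
  assumes "\<forall>c\<in>A. is_chart c"
  shows "openin (tangent_topology A) W \<longleftrightarrow>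
     W \<subseteq> tangent_bundle A \<and> (\<forall>c\<in>A. open (bundle_chart_image c W))"
proof -
  define P where "P W \<longleftrightarrow> W \<subseteq> tangent_bundle A \<and> (\<forall>c\<in>A. open (bundle_chart_image c W))" for W
  have inter: "bundle_chart_image c (V \<inter> W) = bundle_chart_image c V \<inter> bundle_chart_image c W"
    if c: "c \<in> A" and V: "V \<subseteq> tangent_bundle A" and W: "W \<subseteq> tangent_bundle A" for c V W
  proof
    show "bundle_chart_image c (V \<inter> W) \<subseteq> bundle_chart_image c V \<inter> bundle_chart_image c W"
      by (auto simp: bundle_chart_image_def)
    show "bundle_chart_image c V \<inter> bundle_chart_image c W \<subseteq> bundle_chart_image c (V \<inter> W)"
    proof
      fix z assume zV: "z \<in> bundle_chart_image c V \<inter> bundle_chart_image c W"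
      from zV obtain p v where z: "z = (chart_map c p, v c)" "(p, v) \<in> V" "p \<in> chart_dom c"
        unfolding bundle_chart_image_def by blast
      from zV obtain q w where z': "z = (chart_map c q, w c)" "(q, w) \<in> W" "q \<in> chart_dom c"
        unfolding bundle_chart_image_def by blast
      have "inj_on (chart_map c) (chart_dom c)"
        using assms c unfolding is_chart_def homeomorphism_def by (metis inj_on_inverseI)
      then have "p = q"
        using z(1,3) z'(1,3) by (metis inj_onD prod.inject)
      have "v \<in> tangent_space A p" "w \<in> tangent_space A p"
        using V W z(2) z'(2) \<open>p = q\<close> by (auto simp: tangent_bundle_def)
      moreover have "v c = w c"
        using z(1) z'(1) by simp
      ultimately have "v = w"
        using tangent_vector_eqI c z(3) by metis
      then show "z \<in> bundle_chart_image c (V \<inter> W)"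
        using z z'(2) \<open>p = q\<close> unfolding bundle_chart_image_def by blast
    qed
  qed
  have union: "bundle_chart_image c (\<Union>K) = (\<Union>W\<in>K. bundle_chart_image c W)" for c :: "('m, 'e) chart" and K
    by (auto simp: bundle_chart_image_def)
  have "istopology P"
    unfolding istopology_def
  proof (intro conjI allI impI)
    fix V W assume "P V" "P W"
    then show "P (V \<inter> W)"
      unfolding P_def by (simp add: inter le_infI1 open_Int)
  next
    fix K assume "\<forall>W\<in>K. P W"
    then show "P (\<Union>K)"
      unfolding P_def union by (blast intro: open_UN)
  qed
  then have "openin (topology P) = P"
    by (rule topology_inverse')
  moreover have "tangent_topology A = topology P"
    unfolding tangent_topology_def P_def by simp
  ultimately show ?thesis
    by (simp add: P_def)
qed

text \<open>By the chain rule the result does not depend on the chosen chart \<open>c\<close> around \<open>x\<close>.\<close>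

definition differential ::
    "('m, 'e::real_normed_vector) chart set \<Rightarrow> ('m \<Rightarrow> 'm) \<Rightarrow> 'm \<Rightarrow> ('m, 'e) tangent_vector \<Rightarrow> ('m, 'e) tangent_vector" where
  "differential A f x v =
     (let c = (SOME c. c \<in> A \<and> x \<in> chart_dom c) in
      (\<lambda>d. if d \<in> A \<and> f x \<in> chart_dom d
            then frechet_derivative (chart_map d \<circ> f \<circ> chart_inv c) (at (chart_map c x)) (v c)
            else 0))"

definition finsler_metric ::
    "('m, 'e::real_normed_vector) chart set \<Rightarrow> ('m \<times> ('m, 'e) tangent_vector \<Rightarrow> real) \<Rightarrow> bool" where
  "finsler_metric A F \<longleftrightarrow>
     continuous_map (tangent_topology A) euclideanreal F \<and>
     (\<forall>p. \<forall>v\<in>tangent_space A p.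
        F (p, v) \<ge> 0 \<and>
        (F (p, v) = 0 \<longleftrightarrow> v = (\<lambda>c. 0)) \<and>
        (\<forall>a. F (p, \<lambda>c. a *\<^sub>R v c) = \<bar>a\<bar> * F (p, v)) \<and>
        (\<forall>w\<in>tangent_space A p. F (p, \<lambda>c. v c + w c) \<le> F (p, v) + F (p, w)))"

text \<open>Derivatives are one-sided at the end points of the interval.\<close>

definition C1_curve ::
    "('m::topological_space, 'e::real_normed_vector) chart set \<Rightarrow> real \<Rightarrow> real \<Rightarrow> (real \<Rightarrow> 'm) \<Rightarrow> bool" where
  "C1_curve A a b \<gamma> \<longleftrightarrow> continuous_on {a..b} \<gamma> \<and>
     (\<forall>c\<in>A. \<exists>g'. continuous_on ({a..b} \<inter> \<gamma> -` chart_dom c) g' \<and>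
        (\<forall>t\<in>{a..b} \<inter> \<gamma> -` chart_dom c.
           (chart_map c \<circ> \<gamma> has_vector_derivative g' t) (at t within {a..b})))"

definition piecewise_C1_curve ::
    "('m::topological_space, 'e::real_normed_vector) chart set \<Rightarrow> real \<Rightarrow> real \<Rightarrow> (real \<Rightarrow> 'm) \<Rightarrow> bool" where
  "piecewise_C1_curve A a b \<gamma> \<longleftrightarrow>
     (\<exists>n (s :: nat \<Rightarrow> real). s 0 = a \<and> s n = b \<and>
        (\<forall>i<n. s i < s (Suc i) \<and> C1_curve A (s i) (s (Suc i)) \<gamma>))"

definition velocity ::
    "('m, 'e::real_normed_vector) chart set \<Rightarrow> (real \<Rightarrow> 'm) \<Rightarrow> real \<Rightarrow> ('m, 'e) tangent_vector" where
  "velocity A \<gamma> t =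
     (\<lambda>c. if c \<in> A \<and> \<gamma> t \<in> chart_dom c then vector_derivative (chart_map c \<circ> \<gamma>) (at t) else 0)"

text \<open>The velocity of a piecewise \<open>C\<^sup>1\<close> curve may be arbitrary at the finitely many break points
  and end points, which do not affect the integral.\<close>

definition finsler_length ::
    "('m, 'e::real_normed_vector) chart set \<Rightarrow> ('m \<times> ('m, 'e) tangent_vector \<Rightarrow> real) \<Rightarrow>
     real \<Rightarrow> real \<Rightarrow> (real \<Rightarrow> 'm) \<Rightarrow> real" where
  "finsler_length A F a b \<gamma> = integral {a..b} (\<lambda>t. F (\<gamma> t, velocity A \<gamma> t))"

definition finsler_dist ::
    "('m::topological_space, 'e::real_normed_vector) chart set \<Rightarrow> ('m \<times> ('m, 'e) tangent_vector \<Rightarrow> real) \<Rightarrow>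
     'm \<Rightarrow> 'm \<Rightarrow> ereal" where
  "finsler_dist A F x y =
     Inf {ereal (finsler_length A F a b \<gamma>) |a b \<gamma>.
            a < b \<and> piecewise_C1_curve A a b \<gamma> \<and> \<gamma> a = x \<and> \<gamma> b = y}"

end

theory Submission
  imports Defs
begin

text \<open>Near \<open>x\<close>, in a chart, the norms \<open>F(y, \<cdot>)\<close> and \<open>F(x, \<cdot>)\<close> agree up to a factor \<open>1 \<plusminus> \<epsilon>\<close>, uniformly
  in the vector, by compactness of the unit sphere. Straight segments in the chart therefore give
  \<open>d(x, y) \<le> (1 + \<epsilon>) F(x, y - x)\<close> for \<open>y\<close> close to \<open>x\<close>. Conversely every curve from \<open>x\<close> to \<open>y\<close> has
  length at least \<open>(1 - \<epsilon>) F(x, y - x)\<close>: by the triangle inequality for integrals if it stays in the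
  chart, and otherwise because it has to reach the boundary of a fixed ball. Hence \<open>F\<close> is the metric
  derivative of \<open>d\<close>, and a \<open>C\<^sup>1\<close> map that does not increase distances does not increase \<open>F\<close>. The
  converse holds because lengths do not increase. Both are applied to \<open>f\<close> and to its inverse.\<close>

subsection \<open>Derivatives in charts\<close>

text \<open>\<open>F\<close> is merely continuous, so there are no geodesics to follow and no
  derivative of \<open>F\<close> to integrate. The substitute is one fixed norm
  \<open>F(x, \<cdot>)\<close> that is compared with \<open>F(y, \<cdot>)\<close> at nearby points;
  this is why the lower bound for lengths is formulated for a seminorm on the coordinate space that
  does not vary with the point. The fixed ball is forced by the infimum, which also ranges over
  curves that leave the chart and come back. Two features of the setting shape the rest. A tangent
  vector is a family of coordinates over all charts, so computations are moved into one chart by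
  \<open>push\<close>, and a change of chart is treated as the derivative of the identity map.
  Smoothness is a condition on each directional derivative separately, whereas the velocity of an
  image curve is seen to be continuous by joint continuity of the derivative in point and vector.
  The \<epsilon> stays fixed while \<open>y\<close> tends to \<open>x\<close> and is removed only
  afterwards.\<close>

text \<open>Replacing a unit vector by a net point costs at most \<open>onorm L / 2\<close>, so
  \<open>onorm L \<le> C + onorm L / 2\<close>; absorbing the last term gives the factor 2.\<close>

lemma finite_net_bound:
  fixes L :: "'a::real_normed_vector \<Rightarrow> 'b::real_normed_vector"
  assumes L: "bounded_linear L"
    and net: "cball 0 1 \<subseteq> (\<Union>v\<in>V. ball v (1/2))"
    and bound: "\<And>v. v \<in> V \<Longrightarrow> norm (L v) \<le> C"
  shows "norm (L x) \<le> 2 * C * norm x"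
proof -
  interpret L: bounded_linear L by (rule L)
  have unit: "norm (L u) \<le> C + onorm L / 2" if "norm u = 1" for u
  proof -
    have "u \<in> cball 0 1"
      using that by simp
    then obtain v where v: "v \<in> V" "u \<in> ball v (1/2)"
      using net by blast
    have "norm (L u) \<le> norm (L v) + norm (L (u - v))"
      by (metis L.diff add.commute diff_add_cancel norm_triangle_ineq)
    moreover have "norm (L (u - v)) \<le> onorm L * norm (u - v)"
      by (rule onorm[OF L])
    moreover have "onorm L * norm (u - v) \<le> onorm L * (1/2)"
      using v(2) onorm_pos_le[OF L] by (intro mult_left_mono) (auto simp: mem_ball dist_norm norm_minus_commute)
    ultimately show ?thesis
      using bound[OF v(1)] by simp
  qed
  have "norm (L y) \<le> (C + onorm L / 2) * norm y" for y
  proof (cases "y = 0")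
    case False
    then have "norm (L (y /\<^sub>R norm y)) \<le> C + onorm L / 2"
      by (intro unit) simp
    then show ?thesis
      using False by (simp add: L.scaleR field_simps)
  qed (simp add: L.zero)
  \<comment> \<open>In dimension zero there are no unit vectors to yield this, but the net always
    has a point near 0.\<close>
  moreover have "0 \<le> C"
  proof -
    have "(0::'a) \<in> cball 0 1" by simp
    then obtain v where "v \<in> V" using net by blast
    then show ?thesis using bound order_trans[OF norm_ge_zero] by blast
  qed
  ultimately have "onorm L \<le> C + onorm L / 2"
    using onorm_pos_le[OF L] by (intro onorm_bound) auto
  then have "onorm L \<le> 2 * C"
    by simp
  then show ?thesis
    by (meson onorm[OF L] mult_right_mono norm_ge_zero order_trans)
qed

text \<open>The finite net takes the place of the uniform boundedness principle; compactness of the unit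
  ball is where finite dimension enters.\<close>

lemma continuous_on_apply_pointwise:
  fixes T :: "'t::topological_space \<Rightarrow> 'a::{real_normed_vector,heine_borel} \<Rightarrow> 'b::real_normed_vector"
  assumes lin: "\<And>t. t \<in> S \<Longrightarrow> bounded_linear (T t)"
    and cont: "\<And>v. continuous_on S (\<lambda>t. T t v)"
    and e: "continuous_on S e"
  shows "continuous_on S (\<lambda>t. T t (e t))"
  unfolding continuous_on_def
proof
  fix s assume s: "s \<in> S"
  have "compact (cball (0::'a) 1)" by simp
  then obtain V :: "'a set" where V: "finite V" "cball 0 1 \<subseteq> (\<Union>v\<in>V. ball v (1/2))"
    by (rule compactE_image[where C="cball 0 1" and f="\<lambda>v. ball v (1/2)"]) auto
  \<comment> \<open>The sum dominates each of its summands, and the extra 1 leaves room for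
    \<open>t\<close> to move away from \<open>s\<close>.\<close>
  define C where "C = (\<Sum>v\<in>V. norm (T s v) + 1)"
  have C: "norm (T s v) + 1 \<le> C" if "v \<in> V" for v
    unfolding C_def by (rule member_le_sum[OF that]) (auto simp: V)
  have tend: "((\<lambda>t. T t v) \<longlongrightarrow> T s v) (at s within S)" for v
    using cont s by (auto simp: continuous_on_def)
  have "\<forall>\<^sub>F t in at s within S. norm (T t v) < norm (T s v) + 1" for v
    by (rule order_tendstoD(2)[OF tendsto_norm[OF tend]]) simp
  then have "\<forall>\<^sub>F t in at s within S. \<forall>v\<in>V. norm (T t v) < norm (T s v) + 1"
    using V by (simp add: eventually_ball_finite)
  moreover have "\<forall>\<^sub>F t in at s within S. t \<in> S"
    by (simp add: eventually_at_filter)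
  ultimately have "\<forall>\<^sub>F t in at s within S. norm (T t (e t - e s)) \<le> 2 * C * norm (e t - e s)"
  proof eventually_elim
    case (elim t)
    then show ?case
      using C by (intro finite_net_bound[OF lin V(2)]) (auto intro: less_imp_le less_le_trans)
  qed
  moreover have "((\<lambda>t. 2 * C * norm (e t - e s)) \<longlongrightarrow> 0) (at s within S)"
    using e s unfolding continuous_on_def
    by (auto intro!: tendsto_eq_intros tendsto_norm_zero simp: LIM_zero)
  ultimately have "((\<lambda>t. T t (e t - e s)) \<longlongrightarrow> 0) (at s within S)"
    by (rule Lim_null_comparison)
  \<comment> \<open>Splitting \<open>T t (e t)\<close> at \<open>e s\<close>: the uniform bound
    handles the increment of \<open>e\<close>, pointwise continuity handles the fixed vector
    \<open>e s\<close>.\<close>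
  from tendsto_add[OF this tend]
  have "((\<lambda>t. T t (e t - e s) + T t (e s)) \<longlongrightarrow> T s (e s)) (at s within S)"
    by simp
  moreover have "\<forall>\<^sub>F t in at s within S. T t (e t - e s) + T t (e s) = T t (e t)"
    using bounded_linear.linear[OF lin] by (auto simp: eventually_at_filter linear_diff)
  ultimately show "((\<lambda>t. T t (e t)) \<longlongrightarrow> T s (e s)) (at s within S)"
    by (simp add: tendsto_cong)
qed

section \<open>C1 maps and their derivatives in coordinates\<close>

definition coord_map :: "('m \<Rightarrow> 'm) \<Rightarrow> ('m,'e) chart \<Rightarrow> ('m,'e) chart \<Rightarrow> 'e \<Rightarrow> 'e" where
  "coord_map f c d = chart_map d \<circ> f \<circ> chart_inv c"

text \<open>The base point is a point of the manifold rather than its coordinates, so that the chain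
  rule needs no translation between charts. For \<open>f = id\<close> this is the derivative of a
  transition map.\<close>

definition coord_deriv ::
    "('m \<Rightarrow> 'm) \<Rightarrow> ('m,'e::real_normed_vector) chart \<Rightarrow> ('m,'e) chart \<Rightarrow> 'm \<Rightarrow> 'e \<Rightarrow> 'e" where
  "coord_deriv f c d p = frechet_derivative (coord_map f c d) (at (chart_map c p))"

lemma Ck_on_mono: "Ck_on k f S \<Longrightarrow> j \<le> k \<Longrightarrow> Ck_on j f S"
  unfolding Ck_on_def using order_trans by blast

locale C1_manifold =
  fixes A :: "('m::{t2_space,second_countable_topology}, 'e::{banach,heine_borel}) chart set"
  assumes C1_atlas: "differentiable_manifold 1 A"
begin

lemma chart_at: obtains c where "c \<in> A" "p \<in> chart_dom c"
  using C1_atlas unfolding differentiable_manifold_def by blast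

lemma is_chart: "c \<in> A \<Longrightarrow> is_chart c"
  using C1_atlas unfolding differentiable_manifold_def by blast

lemma open_chart_dom [simp]: "c \<in> A \<Longrightarrow> open (chart_dom c)"
  using is_chart unfolding is_chart_def by blast

lemma chart_inv_map [simp]: "c \<in> A \<Longrightarrow> p \<in> chart_dom c \<Longrightarrow> chart_inv c (chart_map c p) = p"
  using is_chart unfolding is_chart_def homeomorphism_def by blast

lemma continuous_on_chart_map: "c \<in> A \<Longrightarrow> continuous_on (chart_dom c) (chart_map c)"
  using is_chart unfolding is_chart_def homeomorphism_def by blast

lemma continuous_on_chart_inv:
  "c \<in> A \<Longrightarrow> continuous_on (chart_map c ` chart_dom c) (chart_inv c)"
  using is_chart unfolding is_chart_def homeomorphism_def by blast

lemma open_chart_image: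
  assumes "c \<in> A" "open W"
  shows "open (chart_map c ` (chart_dom c \<inter> W))"
proof -
  have "chart_map c ` (chart_dom c \<inter> W) = chart_map c ` chart_dom c \<inter> chart_inv c -` W"
    using assms by auto
  moreover have "open (chart_map c ` chart_dom c)"
    using is_chart assms unfolding is_chart_def by blast
  ultimately show ?thesis
    using assms continuous_on_chart_inv by (metis continuous_open_preimage)
qed

lemma open_chart_range [simp]: "c \<in> A \<Longrightarrow> open (chart_map c ` chart_dom c)"
  using open_chart_image[of c UNIV] by simp

text \<open>Transition maps are the coordinate expressions of the identity; hence every fact about
  C1 maps below also covers changes of chart.\<close>

lemma C1_map_id: "Ck_map 1 A id"
proof -
  have "chart_dom c \<inter> id -` chart_dom d = chart_dom c \<inter> chart_dom d" for c d :: "('m, 'e) chart"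
    by simp
  then show ?thesis
    using C1_atlas unfolding Ck_map_def differentiable_manifold_def by (simp add: continuous_on_id)
qed

context
  fixes f assumes f: "Ck_map 1 A f"
begin

lemma C1_map_Cn_on:
  assumes "c \<in> A" "d \<in> A"
  shows "Cn_on 1 (coord_map f c d) (chart_map c ` (chart_dom c \<inter> f -` chart_dom d))"
proof -
  have "enat 1 \<le> 1"
    by (simp add: one_enat_def)
  then show ?thesis
    using f assms unfolding Ck_map_def Ck_on_def coord_map_def by blast
qed

lemma coord_map_has_derivative:
  assumes "c \<in> A" "d \<in> A" "p \<in> chart_dom c" "f p \<in> chart_dom d"
  shows "(coord_map f c d has_derivative coord_deriv f c d p) (at (chart_map c p))"
  using C1_map_Cn_on[OF assms(1,2)] assms(3,4) unfolding coord_deriv_def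
  by (auto simp: frechet_derivative_works)

lemma bounded_linear_coord_deriv:
  assumes "c \<in> A" "d \<in> A" "p \<in> chart_dom c" "f p \<in> chart_dom d"
  shows "bounded_linear (coord_deriv f c d p)"
  using coord_map_has_derivative[OF assms] by (rule has_derivative_bounded_linear)

lemma open_vimage_C1: "open W \<Longrightarrow> open (f -` W)"
  using f unfolding Ck_map_def by (simp add: continuous_on_open_vimage)

lemma continuous_on_coord_deriv:
  assumes cd: "c \<in> A" "d \<in> A" and h: "continuous_on S h" "\<And>t. t \<in> S \<Longrightarrow> h t \<in> chart_dom c"
    "\<And>t. t \<in> S \<Longrightarrow> f (h t) \<in> chart_dom d" and e: "continuous_on S e"
  shows "continuous_on S (\<lambda>t. coord_deriv f c d (h t) (e t))"
proof (rule continuous_on_apply_pointwise[OF _ _ e])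
  show "bounded_linear (coord_deriv f c d (h t))" if "t \<in> S" for t
    using bounded_linear_coord_deriv cd h that by blast
  have ch: "continuous_on S (\<lambda>t. chart_map c (h t))"
    by (rule continuous_on_compose2[OF continuous_on_chart_map[OF cd(1)] h(1)]) (use h in auto)
  fix v
  have "continuous_on (chart_map c ` (chart_dom c \<inter> f -` chart_dom d))
     (\<lambda>q. frechet_derivative (coord_map f c d) (at q) v)"
    using C1_map_Cn_on[OF cd] by simp
  from continuous_on_compose2[OF this ch]
  show "continuous_on S (\<lambda>t. coord_deriv f c d (h t) v)"
    unfolding coord_deriv_def using h by blast
qed

text \<open>The coordinate expression of \<open>g \<circ> f\<close> factors through the chart
  \<open>d\<close> only where \<open>f\<close> takes values in the domain of \<open>d\<close>; this
  is an open neighbourhood of the point, which suffices for derivatives. Taking \<open>f\<close> or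
  \<open>g\<close> to be \<open>id\<close> gives the rules for changing charts.\<close>

lemma coord_deriv_chain:
  assumes g: "Ck_map 1 A g" and "c \<in> A" "d \<in> A" "b \<in> A"
    "p \<in> chart_dom c" "f p \<in> chart_dom d" "g (f p) \<in> chart_dom b"
  shows "coord_deriv (g \<circ> f) c b p = coord_deriv g d b (f p) \<circ> coord_deriv f c d p"
proof -
  have fp: "coord_map f c d (chart_map c p) = chart_map d (f p)"
    using assms by (simp add: coord_map_def)
  have g': "(coord_map g d b has_derivative coord_deriv g d b (f p)) (at (chart_map d (f p)))"
    using g assms by (intro C1_manifold.coord_map_has_derivative) (unfold_locales)
  have "(coord_map g d b \<circ> coord_map f c d has_derivative coord_deriv g d b (f p) \<circ> coord_deriv f c d p)
     (at (chart_map c p))"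
    using coord_map_has_derivative[of c d p] g' assms by (intro diff_chain_at) (simp_all add: fp)
  then have "(coord_map (g \<circ> f) c b has_derivative coord_deriv g d b (f p) \<circ> coord_deriv f c d p)
     (at (chart_map c p))"
  proof (rule has_derivative_transform_within_open)
    show "open (chart_map c ` (chart_dom c \<inter> f -` chart_dom d))"
      using assms by (intro open_chart_image open_vimage_C1) auto
  qed (use assms in \<open>auto simp: coord_map_def\<close>)
  then show ?thesis
    unfolding coord_deriv_def[of "g \<circ> f"] by (rule frechet_derivative_at[symmetric])
qed

end

lemma coord_deriv_id:
  assumes "c \<in> A" "p \<in> chart_dom c"
  shows "coord_deriv id c c p e = e"
proof -
  have "(coord_map id c c has_derivative (\<lambda>e. e)) (at (chart_map c p))"
    by (rule has_derivative_transform_within_open[OF has_derivative_ident open_chart_range[OF assms(1)]])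
      (use assms in \<open>auto simp: coord_map_def\<close>)
  from frechet_derivative_at[OF this] show ?thesis
    unfolding coord_deriv_def by metis
qed

section \<open>Tangent vectors and differentials in coordinates\<close>

text \<open>The image under \<open>df\<close> of the tangent vector at \<open>p\<close> whose coordinate vector in the chart \<open>c\<close> is \<open>e\<close>.
  In particular \<open>push id c p\<close> turns coordinate vectors into tangent vectors at \<open>p\<close>.\<close>

definition push :: "('m \<Rightarrow> 'm) \<Rightarrow> ('m, 'e) chart \<Rightarrow> 'm \<Rightarrow> 'e \<Rightarrow> ('m, 'e) tangent_vector" where
  "push f c p e = (\<lambda>d. if d \<in> A \<and> f p \<in> chart_dom d then coord_deriv f c d p e else 0)"

lemma push_eq_push_id:
  assumes "Ck_map 1 A f" "c \<in> A" "d \<in> A" "p \<in> chart_dom c" "f p \<in> chart_dom d"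
  shows "push f c p e = push id d (f p) (coord_deriv f c d p e)"
proof (rule ext)
  fix b
  have "coord_deriv f c b p e = coord_deriv id d b (f p) (coord_deriv f c d p e)"
    if "b \<in> A \<and> f p \<in> chart_dom b"
    using fun_cong[OF coord_deriv_chain[OF assms(1) C1_map_id, of c d b p], of e] assms that
    by (simp only: id_o comp_apply id_apply simp_thms)
  then show "push f c p e b = push id d (f p) (coord_deriv f c d p e) b"
    unfolding push_def id_apply by presburger
qed

lemma push_id_apply [simp]: "c \<in> A \<Longrightarrow> p \<in> chart_dom c \<Longrightarrow> push id c p e c = e"
  by (simp add: push_def coord_deriv_id)

lemma tangent_space_iff:
  "v \<in> tangent_space A p \<longleftrightarrow>
     (\<forall>c\<in>A. \<forall>d\<in>A. p \<in> chart_dom c \<longrightarrow> p \<in> chart_dom d \<longrightarrow> v d = coord_deriv id c d p (v c)) \<and>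
     (\<forall>c. \<not> (c \<in> A \<and> p \<in> chart_dom c) \<longrightarrow> v c = 0)"
  unfolding tangent_space_def coord_deriv_def coord_map_def by simp

lemma push_id_in_tangent_space:
  assumes "c \<in> A" "p \<in> chart_dom c"
  shows "push id c p e \<in> tangent_space A p"
proof -
  have "coord_deriv id c b p e = coord_deriv id d b p (coord_deriv id c d p e)"
    if "b \<in> A" "d \<in> A" "p \<in> chart_dom b" "p \<in> chart_dom d" for b d
    using fun_cong[OF coord_deriv_chain[OF C1_map_id C1_map_id, of c d b p], of e] assms that
    by (simp only: id_o comp_apply id_apply simp_thms)
  moreover have "push id c p e b = coord_deriv id c b p e" if "b \<in> A" "p \<in> chart_dom b" for b
    using that by (simp add: push_def)
  ultimately show ?thesis
    unfolding tangent_space_iff by (metis id_apply push_def)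
qed

lemma push_in_tangent_space:
  assumes "Ck_map 1 A f" "c \<in> A" "p \<in> chart_dom c"
  shows "push f c p e \<in> tangent_space A (f p)"
proof -
  obtain d where "d \<in> A" "f p \<in> chart_dom d" by (rule chart_at)
  then show ?thesis
    using push_eq_push_id assms push_id_in_tangent_space by metis
qed

lemma tangent_vector_eq_push:
  assumes "v \<in> tangent_space A p" "c \<in> A" "p \<in> chart_dom c"
  shows "v = push id c p (v c)"
  using assms by (intro tangent_vector_eqI[OF assms(1) push_id_in_tangent_space]) auto

text \<open>\<open>differential\<close> selects its chart by Hilbert choice. The chain rule with the
  identity as inner map shows that any other chart around \<open>p\<close> gives the same
  vector.\<close>

lemma differential_eq_push:
  assumes f: "Ck_map 1 A f" and v: "v \<in> tangent_space A p" and c: "c \<in> A" "p \<in> chart_dom c"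
  shows "differential A f p v = push f c p (v c)"
proof -
  define b where "b = (SOME c. c \<in> A \<and> p \<in> chart_dom c)"
  have b: "b \<in> A \<and> p \<in> chart_dom b"
    unfolding b_def by (rule someI[of "\<lambda>c. c \<in> A \<and> p \<in> chart_dom c", OF conjI[OF c]])
  have vb: "v b = coord_deriv id c b p (v c)"
    using v b c unfolding tangent_space_iff by blast
  have "coord_deriv f b d p (v b) = coord_deriv f c d p (v c)" if "d \<in> A" "f p \<in> chart_dom d" for d
    using coord_deriv_chain[OF C1_map_id f, of c b d p] b c that by (simp add: vb)
  then have "push f b p (v b) = push f c p (v c)"
    by (intro ext) (simp add: push_def)
  moreover have "differential A f p v = push f b p (v b)"
    by (simp only: differential_def Let_def b_def[symmetric] push_def coord_deriv_def coord_map_def)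
  ultimately show ?thesis
    by (simp only:)
qed

lemma differential_in_tangent_space:
  assumes "Ck_map 1 A f" "v \<in> tangent_space A p"
  shows "differential A f p v \<in> tangent_space A (f p)"
  using chart_at[of p] differential_eq_push push_in_tangent_space assms by metis

text \<open>The chain rule along the charts \<open>c\<close>, \<open>d\<close>, \<open>c\<close>
  composes the two coordinate derivatives to that of the identity.\<close>

lemma differential_left_inverse:
  assumes f: "Ck_map 1 A f" and g: "Ck_map 1 A g" and gf: "g \<circ> f = id"
    and v: "v \<in> tangent_space A p"
  shows "differential A g (f p) (differential A f p v) = v"
proof -
  obtain c where c: "c \<in> A" "p \<in> chart_dom c" by (rule chart_at)
  obtain d where d: "d \<in> A" "f p \<in> chart_dom d" by (rule chart_at)
  have gfp: "g (f q) = q" for q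
    using gf by (metis comp_apply id_apply)
  have "differential A g (f p) (differential A f p v) = push g d (f p) (differential A f p v d)"
    by (rule differential_eq_push[OF g differential_in_tangent_space[OF f v] d])
  also have "\<dots> = push id c p (coord_deriv g d c (f p) (coord_deriv f c d p (v c)))"
    using push_eq_push_id[OF g, of d c "f p"] c d differential_eq_push[OF f v c]
    by (simp add: gfp push_def)
  also have "\<dots> = push id c p (v c)"
    using coord_deriv_chain[OF f g, of c d c p] c d by (simp add: gf gfp coord_deriv_id fun_eq_iff)
  finally show ?thesis
    using tangent_vector_eq_push[OF v c] by simp
qed

end

subsection \<open>Curves\<close>

text \<open>The coordinates of a velocity in one chart are defined only while the curve stays in
  that chart, so continuity along a curve has to be checked chart by chart.\<close>

lemma continuous_on_locally:
  fixes h :: "'a::topological_space \<Rightarrow> 'b::topological_space"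
  assumes "\<And>t. t \<in> T \<Longrightarrow> \<exists>U. open U \<and> t \<in> U \<and> continuous_on (T \<inter> U) h"
  shows "continuous_on T h"
  unfolding continuous_on_def
proof
  fix t assume t: "t \<in> T"
  obtain U where U: "open U" "t \<in> U" "continuous_on (T \<inter> U) h"
    using assms t by blast
  have "at t within T = at t within (T \<inter> U)"
    by (rule at_within_nhd[OF U(2,1)]) blast
  moreover have "(h \<longlongrightarrow> h t) (at t within (T \<inter> U))"
    using U t by (simp add: continuous_on_def)
  ultimately show "(h \<longlongrightarrow> h t) (at t within T)"
    by simp
qed

text \<open>With an error \<open>\<eta> * (t - s)\<close> added, the inequality is additive over
  adjacent intervals by subadditivity of \<open>N\<close>, and it holds on every short interval
  around a point because \<open>h\<close> and the primitive of \<open>g\<close> are differentiable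
  there. Bisection (\<open>Bolzano\<close>) then yields it on the whole interval. The bound by
  \<open>M\<close> controls \<open>N\<close> on the remainder of \<open>h\<close>.\<close>

lemma seminorm_le_integral:
  fixes h h' :: "real \<Rightarrow> 'e::real_normed_vector" and N :: "'e \<Rightarrow> real"
  assumes "p \<le> q"
    and h: "\<And>t. t \<in> {p..q} \<Longrightarrow> (h has_vector_derivative h' t) (at t within {p..q})"
    and g: "continuous_on {p..q} g" and le: "\<And>t. t \<in> {p..q} \<Longrightarrow> N (h' t) \<le> g t"
    and add: "\<And>x y. N (x + y) \<le> N x + N y" and scale: "\<And>a x. N (a *\<^sub>R x) = \<bar>a\<bar> * N x"
    and M: "0 \<le> M" "\<And>x. N x \<le> M * norm x"
  shows "N (h q - h p) \<le> integral {p..q} g"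
proof (rule field_le_epsilon)
  fix \<epsilon> :: real assume "\<epsilon> > 0"
  \<comment> \<open>Adding 1 keeps the denominator positive when \<open>p = q\<close>.\<close>
  define \<eta> where "\<eta> = \<epsilon> / (q - p + 1)"
  have \<eta>: "\<eta> > 0" "\<eta> * (q - p) \<le> \<epsilon>"
    using \<open>\<epsilon> > 0\<close> \<open>p \<le> q\<close> by (auto simp: \<eta>_def field_simps)
  define \<phi> where "\<phi> t = integral {p..t} g" for t
  have \<phi>: "(\<phi> has_vector_derivative g t) (at t within {p..q})" if "t \<in> {p..q}" for t
    unfolding \<phi>_def by (rule integral_has_vector_derivative[OF g that])
  \<comment> \<open>The premises make \<open>P\<close> trivially true for the short intervals around
    a point that stick out of \<open>{p..q}\<close>.\<close>
  define P where "P s t \<longleftrightarrow> (p \<le> s \<longrightarrow> t \<le> q \<longrightarrow> N (h t - h s) \<le> \<phi> t - \<phi> s + \<eta> * (t - s))" for s t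
  have "P p q"
    using \<open>p \<le> q\<close>
  proof (induction rule: Bolzano)
    case (trans a b c)
    then have "N (h b - h a) \<le> \<phi> b - \<phi> a + \<eta> * (b - a)" "N (h c - h b) \<le> \<phi> c - \<phi> b + \<eta> * (c - b)"
      if "p \<le> a" "c \<le> q"
      using that by (auto simp: P_def)
    with add[of "h c - h b" "h b - h a"] show ?case
      by (auto simp: P_def algebra_simps)
  next
    case (local x)
    \<comment> \<open>The remainder of \<open>h\<close> enters multiplied by \<open>M\<close>, that
      of \<phi> once, so the total error is \<open>(1 + M) * \<kappa> = \<eta>\<close> per unit of
      length.\<close>
    define \<kappa> where "\<kappa> = \<eta> / (1 + M)"
    have \<kappa>: "\<kappa> > 0" "(1 + M) * \<kappa> = \<eta>"
      using M \<eta> by (auto simp: \<kappa>_def)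
    have x: "x \<in> {p..q}" using local by simp
    obtain d1 where d1: "d1 > 0"
      "\<And>y. y \<in> {p..q} \<Longrightarrow> norm (y - x) < d1 \<Longrightarrow> norm (h y - h x - (y - x) *\<^sub>R h' x) \<le> \<kappa> * norm (y - x)"
      using h[OF x] \<kappa> unfolding has_vector_derivative_def has_derivative_within_alt by meson
    obtain d2 where d2: "d2 > 0"
      "\<And>y. y \<in> {p..q} \<Longrightarrow> norm (y - x) < d2 \<Longrightarrow> norm (\<phi> y - \<phi> x - (y - x) *\<^sub>R g x) \<le> \<kappa> * norm (y - x)"
      using \<phi>[OF x] \<kappa> unfolding has_vector_derivative_def has_derivative_within_alt by meson
    show ?case
    proof (intro exI[of _ "min d1 d2"] conjI allI impI)
      fix s t assume st: "s \<le> x \<and> x \<le> t \<and> t - s < min d1 d2"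
      show "P s t"
        unfolding P_def
      proof (intro impI)
        assume "p \<le> s" "t \<le> q"
        then have mem: "s \<in> {p..q}" "t \<in> {p..q}" using st by auto
        define R where "R y = h y - h x - (y - x) *\<^sub>R h' x" for y
        have "norm (R t) \<le> \<kappa> * (t - x)" "norm (R s) \<le> \<kappa> * (x - s)"
          using d1(2)[OF mem(2)] d1(2)[OF mem(1)] st by (auto simp: R_def)
        then have "norm (R t - R s) \<le> \<kappa> * (t - s)"
          using norm_triangle_ineq4[of "R t" "R s"] by (simp add: algebra_simps)
        then have "N (R t - R s) \<le> M * (\<kappa> * (t - s))"
          using M by (meson mult_left_mono order_trans)
        moreover have "h t - h s = (t - s) *\<^sub>R h' x + (R t - R s)"
          by (simp add: R_def algebra_simps)
        ultimately have "N (h t - h s) \<le> (t - s) * N (h' x) + M * (\<kappa> * (t - s))"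
          using add[of "(t - s) *\<^sub>R h' x" "R t - R s"] st by (simp add: scale)
        moreover have "(t - s) * N (h' x) \<le> (t - s) * g x"
          using le[OF x] st by (intro mult_left_mono) auto
        moreover have "\<bar>\<phi> t - \<phi> x - (t - x) * g x\<bar> \<le> \<kappa> * (t - x)" "\<bar>\<phi> s - \<phi> x - (s - x) * g x\<bar> \<le> \<kappa> * (x - s)"
          using d2(2)[OF mem(2)] d2(2)[OF mem(1)] st by auto
        moreover have "\<eta> * (t - s) = \<kappa> * (t - x) + \<kappa> * (x - s) + M * (\<kappa> * (t - s))"
          unfolding \<kappa>(2)[symmetric] by (simp add: algebra_simps)
        ultimately show "N (h t - h s) \<le> \<phi> t - \<phi> s + \<eta> * (t - s)"
          by (simp add: algebra_simps abs_le_iff)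
      qed
    qed (use d1 d2 in auto)
  qed
  then show "N (h q - h p) \<le> integral {p..q} g + \<epsilon>"
    using \<open>p \<le> q\<close> \<eta> by (auto simp: P_def \<phi>_def)
qed

text \<open>Since \<open>a < b\<close> excludes the empty subdivision, the induction starts at the
  first piece and nothing has to be shown for degenerate intervals.\<close>

lemma piecewise_C1_curve_induct [consumes 2, case_names piece join]:
  assumes "piecewise_C1_curve A a b \<gamma>" "a < b"
    and piece: "\<And>s t. s < t \<Longrightarrow> C1_curve A s t \<gamma> \<Longrightarrow> P s t"
    and join: "\<And>s m t. s < m \<Longrightarrow> m < t \<Longrightarrow> P s m \<Longrightarrow> P m t \<Longrightarrow> P s t"
  shows "P a b"
proof -
  obtain n and s :: "nat \<Rightarrow> real" where s: "s 0 = a" "s n = b"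
    "\<And>i. i < n \<Longrightarrow> s i < s (Suc i)" "\<And>i. i < n \<Longrightarrow> C1_curve A (s i) (s (Suc i)) \<gamma>"
    using assms(1) unfolding piecewise_C1_curve_def by blast
  have "j < n \<Longrightarrow> s 0 < s (Suc j) \<and> P (s 0) (s (Suc j))" for j
  proof (induction j)
    case (Suc j)
    then show ?case
      using join[of "s 0" "s (Suc j)" "s (Suc (Suc j))"] piece s(3,4)[of "Suc j"] by auto
  qed (use piece s(3,4)[of 0] in auto)
  moreover obtain j where "n = Suc j"
    using s \<open>a < b\<close> by (cases n) auto
  ultimately show ?thesis
    using s by auto
qed

lemma C1_curve_subset:
  assumes "C1_curve A a b \<gamma>" "{s..t} \<subseteq> {a..b}"
  shows "C1_curve A s t \<gamma>"
  unfolding C1_curve_def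
proof (intro conjI ballI)
  show "continuous_on {s..t} \<gamma>"
    using assms continuous_on_subset unfolding C1_curve_def by blast
  fix c assume "c \<in> A"
  then obtain g' where g': "continuous_on ({a..b} \<inter> \<gamma> -` chart_dom c) g'"
    "\<And>t. t \<in> {a..b} \<inter> \<gamma> -` chart_dom c \<Longrightarrow> (chart_map c \<circ> \<gamma> has_vector_derivative g' t) (at t within {a..b})"
    using assms(1) unfolding C1_curve_def by blast
  have "continuous_on ({s..t} \<inter> \<gamma> -` chart_dom c) g'"
    by (rule continuous_on_subset[OF g'(1)]) (use assms(2) in auto)
  moreover have "(chart_map c \<circ> \<gamma> has_vector_derivative g' u) (at u within {s..t})"
    if "u \<in> {s..t} \<inter> \<gamma> -` chart_dom c" for u
    by (rule has_vector_derivative_within_subset[OF g'(2) assms(2)]) (use assms(2) that in auto)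
  ultimately show "\<exists>g'. continuous_on ({s..t} \<inter> \<gamma> -` chart_dom c) g' \<and>
      (\<forall>t'\<in>{s..t} \<inter> \<gamma> -` chart_dom c.
         (chart_map c \<circ> \<gamma> has_vector_derivative g' t') (at t' within {s..t}))"
    by blast
qed

lemma piecewise_C1_curve_continuous:
  assumes "piecewise_C1_curve A a b \<gamma>" "a < b"
  shows "continuous_on {a..b} \<gamma>"
  using assms
proof (induction rule: piecewise_C1_curve_induct)
  case (join s m t)
  then have "{s..t} = {s..m} \<union> {m..t}" by auto
  then show ?case
    using join by (metis closed_atLeastAtMost continuous_on_closed_Un)
qed (simp add: C1_curve_def)

section \<open>Velocities and images of curves\<close>

context C1_manifold
begin

text \<open>Unlike \<open>velocity\<close>, this is the one-sided velocity at the end points of an interval \<open>S\<close>, so it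
  is continuous along a \<open>C\<^sup>1\<close> curve on all of \<open>S\<close>.\<close>

definition vel :: "(real \<Rightarrow> 'm) \<Rightarrow> real set \<Rightarrow> real \<Rightarrow> ('m, 'e) tangent_vector" where
  "vel \<gamma> S t = (\<lambda>c. if c \<in> A \<and> \<gamma> t \<in> chart_dom c
     then vector_derivative (chart_map c \<circ> \<gamma>) (at t within S) else 0)"

lemma velocity_eq_vel: "a < t \<Longrightarrow> t < b \<Longrightarrow> velocity A \<gamma> t = vel \<gamma> {a..b} t"
  unfolding velocity_def vel_def by (simp add: at_within_Icc_at cong: if_cong)

lemma vel_apply:
  assumes "t \<in> {a..b}" "a < b" "c \<in> A" "\<gamma> t \<in> chart_dom c"
    and "(chart_map c \<circ> \<gamma> has_vector_derivative g') (at t within {a..b})"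
  shows "vel \<gamma> {a..b} t c = g'"
  using vector_derivative_within_cbox[OF assms(2), of t, unfolded box_real, OF assms(1,5)] assms(3,4)
  by (simp add: vel_def)

lemma curve_in_open:
  fixes \<gamma> :: "real \<Rightarrow> 'm"
  assumes "continuous_on S \<gamma>" "open W"
  obtains U where "open U" "S \<inter> U = S \<inter> \<gamma> -` W"
  using assms unfolding continuous_on_open_invariant by (metis inf_commute)

context
  fixes a b \<gamma> assumes \<gamma>: "C1_curve A a b \<gamma>" and ab: "a < b"
begin

lemma C1_curve_has_vector_derivative:
  assumes "t \<in> {a..b}" "c \<in> A" "\<gamma> t \<in> chart_dom c"
  shows "(chart_map c \<circ> \<gamma> has_vector_derivative vel \<gamma> {a..b} t c) (at t within {a..b})"
proof -
  obtain g' where "(chart_map c \<circ> \<gamma> has_vector_derivative g' t) (at t within {a..b})"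
    using \<gamma> assms unfolding C1_curve_def by blast
  then show ?thesis
    using vel_apply assms ab by metis
qed

lemma C1_curve_continuous_vel:
  assumes "c \<in> A"
  shows "continuous_on ({a..b} \<inter> \<gamma> -` chart_dom c) (\<lambda>t. vel \<gamma> {a..b} t c)"
proof -
  obtain g' where g': "continuous_on ({a..b} \<inter> \<gamma> -` chart_dom c) g'"
    "\<And>t. t \<in> {a..b} \<inter> \<gamma> -` chart_dom c \<Longrightarrow> (chart_map c \<circ> \<gamma> has_vector_derivative g' t) (at t within {a..b})"
    using \<gamma> assms unfolding C1_curve_def by blast
  have "vel \<gamma> {a..b} t c = g' t" if "t \<in> {a..b} \<inter> \<gamma> -` chart_dom c" for t
    using vel_apply g'(2)[OF that] that assms ab by blast
  then show ?thesis
    using continuous_on_eq[OF g'(1)] by metis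
qed

lemma continuous_on_C1_curve: "continuous_on {a..b} \<gamma>"
  using \<gamma> unfolding C1_curve_def by blast

lemma C1_curve_map_has_vector_derivative:
  assumes f: "Ck_map 1 A f" and t: "t \<in> {a..b}"
    and c: "c \<in> A" "\<gamma> t \<in> chart_dom c" and d: "d \<in> A" "f (\<gamma> t) \<in> chart_dom d"
  shows "(chart_map d \<circ> (f \<circ> \<gamma>) has_vector_derivative
     coord_deriv f c d (\<gamma> t) (vel \<gamma> {a..b} t c)) (at t within {a..b})"
proof -
  obtain U where U: "open U" "{a..b} \<inter> U = {a..b} \<inter> \<gamma> -` chart_dom c"
    using curve_in_open[OF continuous_on_C1_curve open_chart_dom[OF c(1)]] .
  have "(coord_map f c d has_derivative coord_deriv f c d (\<gamma> t))
      (at ((chart_map c \<circ> \<gamma>) t) within (chart_map c \<circ> \<gamma>) ` {a..b})"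
    using coord_map_has_derivative[OF f c(1) d(1) c(2) d(2)]
    by (simp add: has_derivative_at_withinI)
  from vector_derivative_diff_chain_within[OF C1_curve_has_vector_derivative[OF t c] this]
  have "(coord_map f c d \<circ> (chart_map c \<circ> \<gamma>) has_vector_derivative
      coord_deriv f c d (\<gamma> t) (vel \<gamma> {a..b} t c)) (at t within {a..b})" .
  \<comment> \<open>\<open>chart_inv c\<close> undoes \<open>chart_map c\<close> only while the
    curve is in the domain of \<open>c\<close>, that is, for parameters near
    \<open>t\<close>.\<close>
  moreover have "\<forall>\<^sub>F s in at t within {a..b}.
      (coord_map f c d \<circ> (chart_map c \<circ> \<gamma>)) s = (chart_map d \<circ> (f \<circ> \<gamma>)) s"
  proof -
    have "\<gamma> s \<in> chart_dom c" if "s \<in> U" "s \<in> {a..b}" for s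
      using that U(2) by blast
    moreover have "t \<in> U"
      using U(2) t c by blast
    ultimately show ?thesis
      using U(1) c(1) unfolding eventually_at_topological coord_map_def by (intro exI[of _ U]) simp
  qed
  ultimately show ?thesis
    unfolding has_vector_derivative_def
    by (rule has_derivative_transform_eventually) (use t c in \<open>auto simp: coord_map_def\<close>)
qed

lemma vel_map:
  assumes f: "Ck_map 1 A f" and t: "t \<in> {a..b}" and c: "c \<in> A" "\<gamma> t \<in> chart_dom c"
  shows "vel (f \<circ> \<gamma>) {a..b} t = push f c (\<gamma> t) (vel \<gamma> {a..b} t c)"
proof
  fix d
  show "vel (f \<circ> \<gamma>) {a..b} t d = push f c (\<gamma> t) (vel \<gamma> {a..b} t c) d"
    using vel_apply[OF t ab, of d "f \<circ> \<gamma>"] C1_curve_map_has_vector_derivative[OF f t c, of d]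
    by (cases "d \<in> A \<and> f (\<gamma> t) \<in> chart_dom d") (auto simp: push_def vel_def)
qed

lemma vel_eq_push:
  assumes t: "t \<in> {a..b}" and c: "c \<in> A" "\<gamma> t \<in> chart_dom c"
  shows "vel \<gamma> {a..b} t = push id c (\<gamma> t) (vel \<gamma> {a..b} t c)"
  using vel_map[OF C1_map_id t c] by simp

lemma vel_in_tangent_space:
  assumes "t \<in> {a..b}"
  shows "vel \<gamma> {a..b} t \<in> tangent_space A (\<gamma> t)"
  using chart_at vel_eq_push[OF assms] push_id_in_tangent_space by metis

lemma vel_map_eq_differential:
  assumes f: "Ck_map 1 A f" and t: "t \<in> {a..b}"
  shows "vel (f \<circ> \<gamma>) {a..b} t = differential A f (\<gamma> t) (vel \<gamma> {a..b} t)"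
  using chart_at[of "\<gamma> t"] vel_map[OF f t] differential_eq_push[OF f vel_in_tangent_space[OF t]] by metis

text \<open>The derivative required in the chart \<open>d\<close> is the \<open>d\<close>-coordinate
  of \<open>vel (f \<circ> \<gamma>)\<close>. Near each parameter it is a coordinate derivative of
  \<open>f\<close> applied to the velocity of \<gamma> in some chart \<open>c\<close>, and
  \<open>c\<close> has to change along the curve.\<close>

lemma C1_curve_map:
  assumes f: "Ck_map 1 A f"
  shows "C1_curve A a b (f \<circ> \<gamma>)"
  unfolding C1_curve_def
proof (intro conjI ballI)
  show "continuous_on {a..b} (f \<circ> \<gamma>)"
    using f continuous_on_C1_curve unfolding Ck_map_def
    by (meson continuous_on_compose continuous_on_subset subset_UNIV)
  fix d assume d: "d \<in> A"
  let ?T = "{a..b} \<inter> (f \<circ> \<gamma>) -` chart_dom d"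
  have "continuous_on ?T (\<lambda>t. vel (f \<circ> \<gamma>) {a..b} t d)"
  proof (rule continuous_on_locally)
    fix t assume t: "t \<in> ?T"
    obtain c where c: "c \<in> A" "\<gamma> t \<in> chart_dom c" by (rule chart_at)
    obtain U where U: "open U" "{a..b} \<inter> U = {a..b} \<inter> \<gamma> -` chart_dom c"
      using curve_in_open[OF continuous_on_C1_curve open_chart_dom[OF c(1)]] .
    have mem: "\<gamma> s \<in> chart_dom c" if "s \<in> ?T \<inter> U" for s
      using that U(2) by blast
    have "continuous_on (?T \<inter> U) (\<lambda>t. coord_deriv f c d (\<gamma> t) (vel \<gamma> {a..b} t c))"
    proof (rule continuous_on_coord_deriv[OF f c(1) d])
      show "continuous_on (?T \<inter> U) \<gamma>"
        by (rule continuous_on_subset[OF continuous_on_C1_curve]) auto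
      show "continuous_on (?T \<inter> U) (\<lambda>t. vel \<gamma> {a..b} t c)"
        by (rule continuous_on_subset[OF C1_curve_continuous_vel[OF c(1)]]) (use mem in auto)
    qed (use mem in auto)
    then have "continuous_on (?T \<inter> U) (\<lambda>t. vel (f \<circ> \<gamma>) {a..b} t d)"
    proof (rule continuous_on_eq)
      fix s assume s: "s \<in> ?T \<inter> U"
      then have "s \<in> {a..b}" "\<gamma> s \<in> chart_dom c" "f (\<gamma> s) \<in> chart_dom d"
        using mem by auto
      then show "coord_deriv f c d (\<gamma> s) (vel \<gamma> {a..b} s c) = vel (f \<circ> \<gamma>) {a..b} s d"
        using vel_map[OF f _ c(1)] d by (simp add: push_def)
    qed
    then show "\<exists>U. open U \<and> t \<in> U \<and> continuous_on (?T \<inter> U) (\<lambda>t. vel (f \<circ> \<gamma>) {a..b} t d)"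
      using U t c by (intro exI[of _ U]) blast
  qed
  moreover have "(chart_map d \<circ> (f \<circ> \<gamma>) has_vector_derivative vel (f \<circ> \<gamma>) {a..b} t d) (at t within {a..b})"
    if t: "t \<in> ?T" for t
  proof -
    obtain c where c: "c \<in> A" "\<gamma> t \<in> chart_dom c" by (rule chart_at)
    then show ?thesis
      using C1_curve_map_has_vector_derivative[OF f _ c d] vel_map[OF f _ c] t d
      by (simp add: push_def)
  qed
  ultimately show "\<exists>g'. continuous_on ?T g' \<and>
      (\<forall>t\<in>?T. (chart_map d \<circ> (f \<circ> \<gamma>) has_vector_derivative g' t) (at t within {a..b}))"
    by blast
qed

end

lemma piecewise_C1_curve_map:
  assumes "Ck_map 1 A f" "piecewise_C1_curve A a b \<gamma>"
  shows "piecewise_C1_curve A a b (f \<circ> \<gamma>)"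
proof -
  obtain n and s :: "nat \<Rightarrow> real" where s: "s 0 = a" "s n = b"
    "\<And>i. i < n \<Longrightarrow> s i < s (Suc i) \<and> C1_curve A (s i) (s (Suc i)) \<gamma>"
    using assms(2) unfolding piecewise_C1_curve_def by blast
  then show ?thesis
    using C1_curve_map[OF _ _ assms(1)] unfolding piecewise_C1_curve_def
    by (intro exI[of _ n] exI[of _ s]) simp
qed

end

subsection \<open>Lengths of curves\<close>

locale finsler_manifold = C1_manifold A
  for A :: "('m::{t2_space,second_countable_topology}, 'e::{banach,heine_borel}) chart set" +
  fixes F :: "'m \<times> ('m, 'e) tangent_vector \<Rightarrow> real"
  assumes finsler: "finsler_metric A F"
begin

section \<open>The metric in coordinates\<close>

lemma bundle_chart_imageI:
  "(p, v) \<in> W \<Longrightarrow> p \<in> chart_dom c \<Longrightarrow> (chart_map c p, v c) \<in> bundle_chart_image c W"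
  unfolding bundle_chart_image_def by blast

lemma bundle_chart_image_tangent_bundle:
  assumes "c \<in> A"
  shows "bundle_chart_image c (tangent_bundle A) = (chart_map c ` chart_dom c) \<times> UNIV"
proof -
  have "(chart_map c p, e) \<in> bundle_chart_image c (tangent_bundle A)" if "p \<in> chart_dom c" for p e
    using bundle_chart_imageI[of p "push id c p e" "tangent_bundle A" c] assms that
      push_id_in_tangent_space[OF assms that]
    by (simp add: tangent_bundle_def)
  then show ?thesis
    by (auto simp: bundle_chart_image_def)
qed

lemma topspace_tangent_topology: "topspace (tangent_topology A) = tangent_bundle A"
proof -
  have "openin (tangent_topology A) (tangent_bundle A)"
    using is_chart
    by (simp add: openin_tangent_topology bundle_chart_image_tangent_bundle open_Times)
  moreover have "topspace (tangent_topology A) \<subseteq> tangent_bundle A"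
    using openin_topspace[of "tangent_topology A"] is_chart openin_tangent_topology by blast
  ultimately show ?thesis
    by (meson openin_subset subset_antisym)
qed

text \<open>This translates continuity for the bundle topology into continuity in coordinates, the
  form in which it is applied from here on. The preimage of an open set under \<open>F\<close> has
  an open image in the bundle chart, and a coordinate pair lies in that image exactly when the
  vector it represents lies in the preimage, since the pair determines both point and
  vector.\<close>

lemma continuous_on_F_push:
  fixes h :: "'t::topological_space \<Rightarrow> 'm"
  assumes c: "c \<in> A" and h: "continuous_on S h" "\<And>t. t \<in> S \<Longrightarrow> h t \<in> chart_dom c"
    and e: "continuous_on S e"
  shows "continuous_on S (\<lambda>t. F (h t, push id c (h t) (e t)))"
  unfolding continuous_on_open_invariant
proof (intro allI impI)
  fix U :: "real set" assume "open U"
  define W where "W = {z \<in> tangent_bundle A. F z \<in> U}"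
  have "openin (tangent_topology A) W"
    using finsler \<open>open U\<close> unfolding finsler_metric_def continuous_map_def W_def
    by (auto simp: topspace_tangent_topology)
  then have "open (bundle_chart_image c W)"
    using is_chart c by (simp add: openin_tangent_topology)
  moreover have "continuous_on S (\<lambda>t. (chart_map c (h t), e t))"
    by (intro continuous_on_Pair e continuous_on_compose2[OF continuous_on_chart_map[OF c] h(1)])
      (use h in auto)
  ultimately obtain V where V: "open V"
    "V \<inter> S = (\<lambda>t. (chart_map c (h t), e t)) -` bundle_chart_image c W \<inter> S"
    unfolding continuous_on_open_invariant by blast
  have "(chart_map c p, u) \<in> bundle_chart_image c W \<longleftrightarrow> F (p, push id c p u) \<in> U"
    if p: "p \<in> chart_dom c" for p u
  proof
    assume "(chart_map c p, u) \<in> bundle_chart_image c W"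
    then obtain q v where q: "chart_map c p = chart_map c q" "u = v c" "(q, v) \<in> W" "q \<in> chart_dom c"
      unfolding bundle_chart_image_def by blast
    then have "q = p"
      using chart_inv_map[OF c] p by metis
    then have "v \<in> tangent_space A p"
      using q(3) by (simp add: W_def tangent_bundle_def)
    then have "v = push id c p u"
      using tangent_vector_eq_push c p q(2) by blast
    then show "F (p, push id c p u) \<in> U"
      using q(3) \<open>q = p\<close> by (simp add: W_def)
  next
    assume "F (p, push id c p u) \<in> U"
    then have "(p, push id c p u) \<in> W"
      using push_id_in_tangent_space[OF c p] by (simp add: W_def tangent_bundle_def)
    then show "(chart_map c p, u) \<in> bundle_chart_image c W"
      using bundle_chart_imageI[of p "push id c p u" W c] c p by simp
  qed
  then have "V \<inter> S = (\<lambda>t. F (h t, push id c (h t) (e t))) -` U \<inter> S"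
    unfolding V(2) using h(2) by auto
  then show "\<exists>V. open V \<and> V \<inter> S = (\<lambda>t. F (h t, push id c (h t) (e t))) -` U \<inter> S"
    using V(1) by blast
qed

lemma F_nonneg: "v \<in> tangent_space A p \<Longrightarrow> 0 \<le> F (p, v)"
  using finsler unfolding finsler_metric_def by blast

context
  fixes c p assumes c: "c \<in> A" "p \<in> chart_dom c"
begin

text \<open>Linearity of \<open>push id c p\<close> carries the norm axioms from the tangent space
  to the coordinate space.\<close>

lemma push_id_add: "push id c p (x + y) = (\<lambda>d. push id c p x d + push id c p y d)"
  using linear_add[OF bounded_linear.linear[OF bounded_linear_coord_deriv[OF C1_map_id c(1) _ c(2)]]]
  by (auto simp: push_def)

lemma push_id_scale: "push id c p (a *\<^sub>R x) = (\<lambda>d. a *\<^sub>R push id c p x d)"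
  using linear_scale[OF bounded_linear.linear[OF bounded_linear_coord_deriv[OF C1_map_id c(1) _ c(2)]]]
  by (auto simp: push_def)

lemma F_push_add: "F (p, push id c p (x + y)) \<le> F (p, push id c p x) + F (p, push id c p y)"
  using finsler push_id_in_tangent_space[OF c] unfolding finsler_metric_def push_id_add by blast

lemma F_push_scale: "F (p, push id c p (a *\<^sub>R x)) = \<bar>a\<bar> * F (p, push id c p x)"
  using finsler push_id_in_tangent_space[OF c] unfolding finsler_metric_def push_id_scale by blast

lemma F_push_pos:
  assumes "x \<noteq> 0"
  shows "0 < F (p, push id c p x)"
proof -
  have "push id c p x \<noteq> (\<lambda>c. 0)"
    using push_id_apply[OF c, of x] assms by metis
  then show ?thesis
    using finsler push_id_in_tangent_space[OF c, of x] unfolding finsler_metric_def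
    by (metis order_le_less)
qed

end

section \<open>Speed and its integral\<close>

abbreviation speed :: "(real \<Rightarrow> 'm) \<Rightarrow> real \<Rightarrow> real" where
  "speed \<gamma> t \<equiv> F (\<gamma> t, velocity A \<gamma> t)"

context
  fixes a b \<gamma> assumes \<gamma>: "C1_curve A a b \<gamma>" and ab: "a < b"
begin

lemma continuous_on_F_vel: "continuous_on {a..b} (\<lambda>t. F (\<gamma> t, vel \<gamma> {a..b} t))"
proof (rule continuous_on_locally)
  fix t assume t: "t \<in> {a..b}"
  obtain c where c: "c \<in> A" "\<gamma> t \<in> chart_dom c" by (rule chart_at)
  obtain U where U: "open U" "{a..b} \<inter> U = {a..b} \<inter> \<gamma> -` chart_dom c"
    using curve_in_open[OF continuous_on_C1_curve[OF \<gamma> ab] open_chart_dom[OF c(1)]] .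
  have mem: "\<gamma> s \<in> chart_dom c" if "s \<in> {a..b} \<inter> U" for s
    using that U(2) by blast
  have "continuous_on ({a..b} \<inter> U) (\<lambda>t. F (\<gamma> t, push id c (\<gamma> t) (vel \<gamma> {a..b} t c)))"
  proof (rule continuous_on_F_push[OF c(1)])
    show "continuous_on ({a..b} \<inter> U) \<gamma>"
      by (rule continuous_on_subset[OF continuous_on_C1_curve[OF \<gamma> ab]]) auto
    show "continuous_on ({a..b} \<inter> U) (\<lambda>t. vel \<gamma> {a..b} t c)"
      by (rule continuous_on_subset[OF C1_curve_continuous_vel[OF \<gamma> ab c(1)]]) (use mem in auto)
  qed (use mem in auto)
  then have "continuous_on ({a..b} \<inter> U) (\<lambda>t. F (\<gamma> t, vel \<gamma> {a..b} t))"
    by (rule continuous_on_eq) (metis IntD1 mem vel_eq_push[OF \<gamma> ab _ c(1)])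
  then show "\<exists>U. open U \<and> t \<in> U \<and> continuous_on ({a..b} \<inter> U) (\<lambda>t. F (\<gamma> t, vel \<gamma> {a..b} t))"
    using U t c by (intro exI[of _ U]) blast
qed

text \<open>The two-sided derivative in \<open>velocity\<close> may be meaningless at the end
  points. Off these two points it agrees with the one-sided \<open>vel\<close>, along which
  \<open>F\<close> is continuous, and two points do not affect an integral.\<close>

lemma speed_eq: "t \<in> {a..b} - {a, b} \<Longrightarrow> speed \<gamma> t = F (\<gamma> t, vel \<gamma> {a..b} t)"
  by (simp add: velocity_eq_vel[of a t b])

lemma speed_integrable: "speed \<gamma> integrable_on {a..b}"
  by (rule integrable_spike_finite[of "{a, b}", OF _ speed_eq integrable_continuous_real[OF continuous_on_F_vel]]) auto

lemma integral_speed: "integral {a..b} (speed \<gamma>) = integral {a..b} (\<lambda>t. F (\<gamma> t, vel \<gamma> {a..b} t))"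
  by (rule integral_spike[of "{a, b}"]) (use speed_eq in auto)

lemma integral_speed_nonneg: "0 \<le> integral {a..b} (speed \<gamma>)"
  unfolding integral_speed
proof (rule integral_nonneg)
  show "(\<lambda>t. F (\<gamma> t, vel \<gamma> {a..b} t)) integrable_on {a..b}"
    by (intro integrable_continuous_real continuous_on_F_vel)
qed (intro F_nonneg vel_in_tangent_space[OF \<gamma> ab])

lemma seminorm_le_integral_speed:
  fixes N :: "'e \<Rightarrow> real"
  assumes c: "c \<in> A" "\<gamma> ` {a..b} \<subseteq> K" "K \<subseteq> chart_dom c"
    and le: "\<And>y e. y \<in> K \<Longrightarrow> N e \<le> F (y, push id c y e)"
    and "\<And>x y. N (x + y) \<le> N x + N y" "\<And>a x. N (a *\<^sub>R x) = \<bar>a\<bar> * N x"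
    and "0 \<le> M" "\<And>x. N x \<le> M * norm x"
  shows "N (chart_map c (\<gamma> b) - chart_map c (\<gamma> a)) \<le> integral {a..b} (speed \<gamma>)"
proof -
  have "N ((chart_map c \<circ> \<gamma>) b - (chart_map c \<circ> \<gamma>) a) \<le> integral {a..b} (\<lambda>t. F (\<gamma> t, vel \<gamma> {a..b} t))"
  proof (rule seminorm_le_integral[where h'="\<lambda>t. vel \<gamma> {a..b} t c"])
    fix t assume t: "t \<in> {a..b}"
    then have K: "\<gamma> t \<in> K" "\<gamma> t \<in> chart_dom c" using c(2,3) by blast+
    show "(chart_map c \<circ> \<gamma> has_vector_derivative vel \<gamma> {a..b} t c) (at t within {a..b})"
      by (rule C1_curve_has_vector_derivative[OF \<gamma> ab t c(1) K(2)])
    show "N (vel \<gamma> {a..b} t c) \<le> F (\<gamma> t, vel \<gamma> {a..b} t)"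
      using le[OF K(1)] vel_eq_push[OF \<gamma> ab t c(1) K(2)] by metis
  qed (use assms ab continuous_on_F_vel in auto)
  then show ?thesis
    by (simp add: integral_speed)
qed

end

lemma integral_speed_C1_map_le:
  assumes \<gamma>: "C1_curve A a b \<gamma>" and ab: "a < b" and f: "Ck_map 1 A f"
    and le: "\<And>x v. v \<in> tangent_space A x \<Longrightarrow> F (f x, differential A f x v) \<le> F (x, v)"
  shows "integral {a..b} (speed (f \<circ> \<gamma>)) \<le> integral {a..b} (speed \<gamma>)"
  unfolding integral_speed[OF \<gamma> ab] integral_speed[OF C1_curve_map[OF \<gamma> ab f] ab]
proof (rule integral_le)
  show "F ((f \<circ> \<gamma>) t, vel (f \<circ> \<gamma>) {a..b} t) \<le> F (\<gamma> t, vel \<gamma> {a..b} t)" if "t \<in> {a..b}" for t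
    using le[OF vel_in_tangent_space[OF \<gamma> ab that]] vel_map_eq_differential[OF \<gamma> ab f that] by simp
qed (intro integrable_continuous_real continuous_on_F_vel C1_curve_map \<gamma> ab f)+

lemma speed_integrable_piecewise:
  assumes "piecewise_C1_curve A a b \<gamma>" "a < b"
  shows "speed \<gamma> integrable_on {a..b}"
  using assms
proof (induction rule: piecewise_C1_curve_induct)
  case (join s m t)
  then show ?case
    using Henstock_Kurzweil_Integration.integrable_combine[of s m t "speed \<gamma>"] by simp
qed (rule speed_integrable)

lemma finsler_length_C1_map_le:
  assumes f: "Ck_map 1 A f"
    and le: "\<And>x v. v \<in> tangent_space A x \<Longrightarrow> F (f x, differential A f x v) \<le> F (x, v)"
    and \<gamma>: "piecewise_C1_curve A a b \<gamma>" "a < b"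
  shows "finsler_length A F a b (f \<circ> \<gamma>) \<le> finsler_length A F a b \<gamma>"
proof -
  \<comment> \<open>Integrability is carried through the induction because splitting the integral at
    a joint requires it.\<close>
  have "speed \<gamma> integrable_on {a..b} \<and> speed (f \<circ> \<gamma>) integrable_on {a..b} \<and>
      integral {a..b} (speed (f \<circ> \<gamma>)) \<le> integral {a..b} (speed \<gamma>)"
    using \<gamma>
  proof (induction rule: piecewise_C1_curve_induct)
    case (piece s t)
    then show ?case
      using speed_integrable C1_curve_map[OF _ _ f] integral_speed_C1_map_le[OF _ _ f le] by blast
  next
    case (join s m t)
    note combine = Henstock_Kurzweil_Integration.integrable_combine[of s m t]
      Henstock_Kurzweil_Integration.integral_combine[of s m t]
    have "speed \<gamma> integrable_on {s..t}" "speed (f \<circ> \<gamma>) integrable_on {s..t}"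
      using join combine(1)[of "speed \<gamma>"] combine(1)[of "speed (f \<circ> \<gamma>)"]
      by (meson less_imp_le)+
    with join combine(2)[of "speed \<gamma>"] combine(2)[of "speed (f \<circ> \<gamma>)"] show ?case
      by linarith
  qed
  then show ?thesis
    by (simp add: finsler_length_def)
qed

lemma finsler_dist_le:
  assumes "a < b" "piecewise_C1_curve A a b \<gamma>"
  shows "finsler_dist A F (\<gamma> a) (\<gamma> b) \<le> ereal (finsler_length A F a b \<gamma>)"
  unfolding finsler_dist_def using assms by (intro Inf_lower) blast

lemma finsler_dist_greatest:
  assumes "\<And>a b \<gamma>. a < b \<Longrightarrow> piecewise_C1_curve A a b \<gamma> \<Longrightarrow> \<gamma> a = x \<Longrightarrow> \<gamma> b = y \<Longrightarrow>
      L \<le> ereal (finsler_length A F a b \<gamma>)"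
  shows "L \<le> finsler_dist A F x y"
  unfolding finsler_dist_def using assms by (intro Inf_greatest) blast

text \<open>The image of each curve from \<open>x\<close> to \<open>y\<close> competes for the
  distance of the images. If no such curve exists, the right-hand side is infinite.\<close>

lemma finsler_dist_C1_map_le:
  assumes f: "Ck_map 1 A f"
    and le: "\<And>x v. v \<in> tangent_space A x \<Longrightarrow> F (f x, differential A f x v) \<le> F (x, v)"
  shows "finsler_dist A F (f x) (f y) \<le> finsler_dist A F x y"
proof (rule finsler_dist_greatest)
  fix a b \<gamma> assume \<gamma>: "a < b" "piecewise_C1_curve A a b \<gamma>" "\<gamma> a = x" "\<gamma> b = y"
  show "finsler_dist A F (f x) (f y) \<le> ereal (finsler_length A F a b \<gamma>)"
    using finsler_dist_le[OF \<gamma>(1) piecewise_C1_curve_map[OF f \<gamma>(2)]]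
      finsler_length_C1_map_le[OF f le \<gamma>(2,1)] \<gamma>(3,4)
    by (auto intro: order_trans)
qed

end

lemma compact_sphere_heine_borel:
  fixes a :: "'a::heine_borel"
  shows "compact (sphere a r)"
proof -
  have "sphere a r = cball a r - ball a r" by auto
  then show ?thesis by (simp add: compact_diff)
qed

subsection \<open>Comparison of the distance with the norm at a point\<close>

context finsler_manifold
begin

text \<open>The bounds are given on arbitrary subintervals because a curve will be cut where it
  first reaches the boundary of \<open>K\<close>, which need not be a break point. The first
  conclusion allows the rest of the curve to be discarded.\<close>

lemma seminorm_le_integral_speed_piecewise:
  fixes N :: "'e \<Rightarrow> real"
  assumes "piecewise_C1_curve A a b \<gamma>" "a < b" and c: "c \<in> A" and K: "K \<subseteq> chart_dom c"
    and le: "\<And>y e. y \<in> K \<Longrightarrow> N e \<le> F (y, push id c y e)"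
    and add: "\<And>x y. N (x + y) \<le> N x + N y" and scale: "\<And>a x. N (a *\<^sub>R x) = \<bar>a\<bar> * N x"
    and M: "0 \<le> M" "\<And>x. N x \<le> M * norm x"
    and pq: "a \<le> p" "p \<le> q" "q \<le> b"
  shows "0 \<le> integral {p..q} (speed \<gamma>)"
    and "\<gamma> ` {p..q} \<subseteq> K \<Longrightarrow> N (chart_map c (\<gamma> q) - chart_map c (\<gamma> p)) \<le> integral {p..q} (speed \<gamma>)"
proof -
  define lb where "lb p q \<longleftrightarrow> 0 \<le> integral {p..q} (speed \<gamma>) \<and>
    (\<gamma> ` {p..q} \<subseteq> K \<longrightarrow> N (chart_map c (\<gamma> q) - chart_map c (\<gamma> p)) \<le> integral {p..q} (speed \<gamma>))"
    for p q
  have "speed \<gamma> integrable_on {a..b} \<and> (\<forall>p q. a \<le> p \<longrightarrow> p \<le> q \<longrightarrow> q \<le> b \<longrightarrow> lb p q)"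
    using assms(1,2)
  proof (induction rule: piecewise_C1_curve_induct)
    case (piece s t)
    have "lb p q" if "s \<le> p" "p \<le> q" "q \<le> t" for p q
    proof (cases "p = q")
      case True
      then show ?thesis
        using scale[of 0 0] by (simp add: lb_def)
    next
      case False
      have \<gamma>: "C1_curve A p q \<gamma>" "p < q"
        using C1_curve_subset[OF piece(2), of p q] that False by auto
      show ?thesis
        unfolding lb_def
        using integral_speed_nonneg[OF \<gamma>] seminorm_le_integral_speed[OF \<gamma> c _ K le add scale M] by blast
    qed
    then show ?case
      using speed_integrable[OF piece(2,1)] by blast
  next
    case (join s m t)
    have int: "speed \<gamma> integrable_on {s..t}"
      using join Henstock_Kurzweil_Integration.integrable_combine[of s m t "speed \<gamma>"] by simp
    have "lb p q" if pq: "s \<le> p" "p \<le> q" "q \<le> t" for p q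
    proof -
      consider "q \<le> m" | "m \<le> p" | "p < m" "m < q" by linarith
      then show ?thesis
      proof cases
        case 3
        then have lb: "lb p m" "lb m q"
          using join pq by simp_all
        have "speed \<gamma> integrable_on {p..q}"
          using integrable_subinterval_real[OF int] pq by simp
        then have eq: "integral {p..m} (speed \<gamma>) + integral {m..q} (speed \<gamma>) = integral {p..q} (speed \<gamma>)"
          using 3 by (intro Henstock_Kurzweil_Integration.integral_combine) auto
        have "\<gamma> ` {p..m} \<subseteq> K \<and> \<gamma> ` {m..q} \<subseteq> K" if "\<gamma> ` {p..q} \<subseteq> K"
          using that 3 by force
        then show ?thesis
          using lb eq add[of "chart_map c (\<gamma> q) - chart_map c (\<gamma> m)" "chart_map c (\<gamma> m) - chart_map c (\<gamma> p)"]
          unfolding lb_def by force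
      qed (use join pq in simp_all)
    qed
    then show ?case
      using int by blast
  qed
  then have "lb p q"
    using pq by blast
  then show "0 \<le> integral {p..q} (speed \<gamma>)"
    and "\<gamma> ` {p..q} \<subseteq> K \<Longrightarrow> N (chart_map c (\<gamma> q) - chart_map c (\<gamma> p)) \<le> integral {p..q} (speed \<gamma>)"
    unfolding lb_def by blast+
qed

context
  fixes c x assumes c: "c \<in> A" "x \<in> chart_dom c"
begin

lemma continuous_on_F_push_point: "continuous_on S (\<lambda>e. F (x, push id c x e))"
  using continuous_on_F_push[OF c(1), of S "\<lambda>_. x" "\<lambda>e. e"] c(2) by simp

lemma F_push_norm_bounds:
  obtains m M where "0 < m" "0 < M"
    "\<And>e. m * norm e \<le> F (x, push id c x e)" "\<And>e. F (x, push id c x e) \<le> M * norm e"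
proof -
  let ?N = "\<lambda>e. F (x, push id c x e)"
  have zero: "?N 0 = 0"
    using F_push_scale[OF c, of 0 0] by simp
  show thesis
  proof (cases "sphere (0::'e) 1 = {}")
    \<comment> \<open>The unit sphere is empty in dimension zero; then both sides vanish and any
      positive constants serve.\<close>
    case True
    have "e = 0" for e :: 'e
    proof (rule ccontr)
      assume "e \<noteq> 0"
      then have "e /\<^sub>R norm e \<in> sphere 0 1" by simp
      with True show False by blast
    qed
    then have "?N e = 0" "norm e = 0" for e
      using zero by (metis, metis norm_zero)
    then show thesis
      using that[of 1 1] by simp
  next
    case False
    obtain u where u: "u \<in> sphere 0 1" "\<And>e. e \<in> sphere 0 1 \<Longrightarrow> ?N u \<le> ?N e"
      using continuous_attains_inf[OF compact_sphere_heine_borel False continuous_on_F_push_point] by blast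
    obtain w where w: "w \<in> sphere 0 1" "\<And>e. e \<in> sphere 0 1 \<Longrightarrow> ?N e \<le> ?N w"
      using continuous_attains_sup[OF compact_sphere_heine_borel False continuous_on_F_push_point] by blast
    have pos: "0 < ?N u" "0 < ?N w"
      using u(1) w(1) F_push_pos[OF c] by force+
    have "?N u * norm e \<le> ?N e \<and> ?N e \<le> ?N w * norm e" for e
    proof (cases "e = 0")
      case True
      then show ?thesis using zero by simp
    next
      case False
      then have "e /\<^sub>R norm e \<in> sphere 0 1" by simp
      then have "?N u \<le> ?N (e /\<^sub>R norm e)" "?N (e /\<^sub>R norm e) \<le> ?N w"
        using u w by blast+
      then show ?thesis
        using False unfolding F_push_scale[OF c] by (simp add: field_simps)
    qed
    then show thesis
      using that pos by blast
  qed
qed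

text \<open>Uniform continuity on a compact ball times the unit sphere gives an additive error
  \<open>\<epsilon> * m\<close>. As \<open>m\<close> bounds \<open>F(x, \<cdot>)\<close> from below
  on the sphere, the error is also relative, and homogeneity extends it to all vectors.\<close>

lemma F_push_locally_close:
  assumes "\<epsilon> > 0"
  obtains r where "r > 0" "cball (chart_map c x) r \<subseteq> chart_map c ` chart_dom c"
    "\<And>y e. y \<in> chart_dom c \<Longrightarrow> dist (chart_map c y) (chart_map c x) \<le> r \<Longrightarrow>
       \<bar>F (y, push id c y e) - F (x, push id c x e)\<bar> \<le> \<epsilon> * F (x, push id c x e)"
proof -
  obtain m M where m: "0 < m" "\<And>e. m * norm e \<le> F (x, push id c x e)"
    by (rule F_push_norm_bounds) blast
  obtain r0 where r0: "r0 > 0" "cball (chart_map c x) r0 \<subseteq> chart_map c ` chart_dom c"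
    using open_chart_range[OF c(1)] c(2) unfolding open_contains_cball by blast
  define S where "S = cball (chart_map c x) r0 \<times> sphere (0::'e) 1"
  define G where "G z = F (chart_inv c (fst z), push id c (chart_inv c (fst z)) (snd z))" for z
  have in_dom: "chart_inv c (fst z) \<in> chart_dom c" if "z \<in> S" for z
  proof -
    have "fst z \<in> chart_map c ` chart_dom c"
      using r0(2) that unfolding S_def by auto
    then show ?thesis
      using c(1) by auto
  qed
  have "continuous_on S G"
    unfolding G_def
  proof (rule continuous_on_F_push[OF c(1) _ in_dom])
    show "continuous_on S (\<lambda>z. chart_inv c (fst z))"
      by (rule continuous_on_compose2[OF continuous_on_chart_inv[OF c(1)]])
        (use r0(2) in \<open>auto simp: S_def intro!: continuous_intros\<close>)
    show "continuous_on S snd"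
      using continuous_on_snd[OF continuous_on_id[of S]] by simp
  qed
  moreover have "compact S"
    unfolding S_def by (intro compact_Times compact_sphere_heine_borel) auto
  ultimately have "uniformly_continuous_on S G"
    by (rule compact_uniformly_continuous)
  then have "\<exists>d>0. \<forall>z\<in>S. \<forall>w\<in>S. dist w z < d \<longrightarrow> dist (G w) (G z) < \<epsilon> * m"
    using mult_pos_pos[OF assms m(1)] unfolding uniformly_continuous_on_def by simp
  then obtain d where d: "d > 0"
    "\<And>z w. z \<in> S \<Longrightarrow> w \<in> S \<Longrightarrow> dist w z < d \<Longrightarrow> dist (G w) (G z) < \<epsilon> * m"
    by blast
  show thesis
  proof (rule that)
    \<comment> \<open>Halving \<open>d\<close> turns the strict inequality of uniform continuity
      into one valid on a closed ball.\<close>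
    show "min r0 (d/2) > 0" "cball (chart_map c x) (min r0 (d/2)) \<subseteq> chart_map c ` chart_dom c"
      using r0 d by auto
    fix y e assume y: "y \<in> chart_dom c" "dist (chart_map c y) (chart_map c x) \<le> min r0 (d/2)"
    show "\<bar>F (y, push id c y e) - F (x, push id c x e)\<bar> \<le> \<epsilon> * F (x, push id c x e)"
    proof (cases "e = 0")
      case True
      then show ?thesis
        using F_push_scale[OF c, of 0 0] F_push_scale[OF c(1) y(1), of 0 0] by simp
    next
      case False
      define u where "u = e /\<^sub>R norm e"
      have u: "u \<in> sphere 0 1" "e = norm e *\<^sub>R u"
        using False by (auto simp: u_def)
      have "dist (G (chart_map c y, u)) (G (chart_map c x, u)) < \<epsilon> * m"
        using u y r0 d(1) by (intro d(2)) (auto simp: S_def dist_Pair_Pair dist_commute)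
      then have "\<bar>F (y, push id c y u) - F (x, push id c x u)\<bar> \<le> \<epsilon> * m"
        using y c by (simp add: G_def dist_real_def)
      also have "\<dots> \<le> \<epsilon> * F (x, push id c x u)"
        using m(2)[of u] u(1) \<open>\<epsilon> > 0\<close> by (intro mult_left_mono) auto
      finally have "norm e * \<bar>F (y, push id c y u) - F (x, push id c x u)\<bar> \<le>
          norm e * (\<epsilon> * F (x, push id c x u))"
        by (rule mult_left_mono) simp
      moreover have "F (y, push id c y e) = norm e * F (y, push id c y u)"
        "F (x, push id c x e) = norm e * F (x, push id c x u)"
        using F_push_scale[OF c(1) y(1), of "norm e" u] F_push_scale[OF c, of "norm e" u] u(2) by simp_all
      ultimately show ?thesis
        by (simp add: abs_mult right_diff_distrib[symmetric] mult.left_commute)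
    qed
  qed
qed

text \<open>The closed coordinate ball \<open>K\<close> is compact, hence closed in the Hausdorff
  manifold, so a curve cannot slip out of the chart without meeting the boundary sphere. At the
  first time \<tau> outside the open ball \<open>U\<close>, closedness keeps the point in
  \<open>K\<close>, so its distance from the centre is exactly \<open>r\<close>.\<close>

lemma exit_from_chart_ball:
  fixes \<gamma> :: "real \<Rightarrow> 'm"
  assumes "r > 0" and r: "cball (chart_map c x) r \<subseteq> chart_map c ` chart_dom c"
    and K: "K = {y \<in> chart_dom c. dist (chart_map c y) (chart_map c x) \<le> r}"
    and \<gamma>: "continuous_on {a..b} \<gamma>" "\<gamma> a = x"
  obtains "\<gamma> ` {a..b} \<subseteq> K"
  | \<tau> where "\<tau> \<in> {a..b}" "\<gamma> ` {a..\<tau>} \<subseteq> K" "dist (chart_map c (\<gamma> \<tau>)) (chart_map c x) = r"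
proof -
  define U where "U = {y \<in> chart_dom c. dist (chart_map c y) (chart_map c x) < r}"
  have "U \<subseteq> K" by (auto simp: U_def K)
  have "K = chart_inv c ` cball (chart_map c x) r"
  proof (intro equalityI subsetI)
    fix y assume "y \<in> K"
    then have "y = chart_inv c (chart_map c y)" "chart_map c y \<in> cball (chart_map c x) r"
      using c(1) by (auto simp: K dist_commute)
    then show "y \<in> chart_inv c ` cball (chart_map c x) r" by blast
  next
    fix y assume "y \<in> chart_inv c ` cball (chart_map c x) r"
    then obtain q where q: "y = chart_inv c q" "q \<in> cball (chart_map c x) r" by blast
    then obtain p where "p \<in> chart_dom c" "q = chart_map c p" using r by blast
    then show "y \<in> K" using q c(1) by (auto simp: K dist_commute)
  qed
  moreover have "compact (chart_inv c ` cball (chart_map c x) r)"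
    by (intro compact_continuous_image continuous_on_subset[OF continuous_on_chart_inv[OF c(1)] r]) simp
  ultimately have "closed K"
    by (simp add: compact_imp_closed)
  have "U = chart_dom c \<inter> chart_map c -` ball (chart_map c x) r"
    by (auto simp: U_def dist_commute)
  then have "open U"
    using continuous_open_preimage[OF continuous_on_chart_map[OF c(1)] open_chart_dom[OF c(1)] open_ball]
    by simp
  define T where "T = {a..b} \<inter> \<gamma> -` (- U)"
  have "closed T"
    unfolding T_def using \<open>open U\<close> by (intro continuous_closed_preimage \<gamma> closed_atLeastAtMost) auto
  then have "compact T"
    unfolding compact_eq_bounded_closed by (auto simp: T_def bounded_Int)
  show thesis
  proof (cases "T = {}")
    case True
    then have "\<gamma> ` {a..b} \<subseteq> U" by (auto simp: T_def)
    then show thesis using that(1) \<open>U \<subseteq> K\<close> by blast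
  next
    case False
    then obtain \<tau> where \<tau>: "\<tau> \<in> T" "\<And>t. t \<in> T \<Longrightarrow> \<tau> \<le> t"
      using compact_attains_inf[OF \<open>compact T\<close>] by blast
    have "\<gamma> a \<in> U"
      using \<gamma>(2) c \<open>r > 0\<close> by (simp add: U_def)
    then have "a < \<tau>"
      using \<tau>(1) by (cases "a = \<tau>") (auto simp: T_def)
    have before: "\<gamma> t \<in> U" if "a \<le> t" "t < \<tau>" for t
      using \<tau> that by (force simp: T_def)
    have "closed ({a..\<tau>} \<inter> \<gamma> -` K)"
      by (intro continuous_closed_preimage continuous_on_subset[OF \<gamma>(1)] \<open>closed K\<close>)
        (use \<tau>(1) in \<open>auto simp: T_def\<close>)
    moreover have "{a..<\<tau>} \<subseteq> {a..\<tau>} \<inter> \<gamma> -` K"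
      using subsetD[OF \<open>U \<subseteq> K\<close> before] by auto
    ultimately have "closure {a..<\<tau>} \<subseteq> {a..\<tau>} \<inter> \<gamma> -` K"
      by (rule closure_minimal[rotated])
    then have "\<gamma> ` {a..\<tau>} \<subseteq> K"
      using \<open>a < \<tau>\<close> by auto
    moreover have "\<gamma> \<tau> \<in> K - U"
      using \<tau>(1) \<open>a < \<tau>\<close> \<open>\<gamma> ` {a..\<tau>} \<subseteq> K\<close> by (auto simp: T_def)
    then have "dist (chart_map c (\<gamma> \<tau>)) (chart_map c x) = r"
      by (auto simp: K U_def)
    ultimately show thesis
      using that(2) \<tau>(1) by (auto simp: T_def)
  qed
qed

text \<open>The radius \<open>m * r / M\<close> balances the two norm bounds: within it
  \<open>F(x, \<cdot>)\<close> of the displacement is at most \<open>m * r\<close>, while every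
  displacement of norm \<open>r\<close> has at least this value. A curve that reaches the sphere
  therefore satisfies the bound by its initial part alone.\<close>

lemma finsler_dist_lower:
  assumes "0 < \<epsilon>" "\<epsilon> < 1"
  obtains \<delta> where "\<delta> > 0"
    "\<And>y. y \<in> chart_dom c \<Longrightarrow> dist (chart_map c y) (chart_map c x) < \<delta> \<Longrightarrow>
       ereal ((1 - \<epsilon>) * F (x, push id c x (chart_map c y - chart_map c x))) \<le> finsler_dist A F x y"
proof -
  define N where "N e = (1 - \<epsilon>) * F (x, push id c x e)" for e
  obtain m M where m: "0 < m" "\<And>e. m * norm e \<le> F (x, push id c x e)"
    and M: "0 < M" "\<And>e. F (x, push id c x e) \<le> M * norm e"
    by (rule F_push_norm_bounds) blast
  obtain r where r: "r > 0" "cball (chart_map c x) r \<subseteq> chart_map c ` chart_dom c"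
    "\<And>y e. y \<in> chart_dom c \<Longrightarrow> dist (chart_map c y) (chart_map c x) \<le> r \<Longrightarrow>
       \<bar>F (y, push id c y e) - F (x, push id c x e)\<bar> \<le> \<epsilon> * F (x, push id c x e)"
    by (rule F_push_locally_close[OF assms(1)]) blast
  define K where "K = {y \<in> chart_dom c. dist (chart_map c y) (chart_map c x) \<le> r}"
  have N_le: "N e \<le> F (y, push id c y e)" if "y \<in> K" for y e
    using r(3)[of y e] that unfolding K_def N_def by (simp add: algebra_simps abs_le_iff)
  have N_add: "N (u + w) \<le> N u + N w" for u w
    using mult_left_mono[OF F_push_add[OF c, of u w], of "1 - \<epsilon>"] assms
    by (simp add: N_def algebra_simps)
  have N_scale: "N (s *\<^sub>R u) = \<bar>s\<bar> * N u" for s u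
    by (simp add: N_def F_push_scale[OF c])
  have N_bound: "N u \<le> M * norm u" for u
  proof -
    have "N u \<le> 1 * F (x, push id c x u)"
      unfolding N_def using assms F_nonneg[OF push_id_in_tangent_space[OF c]]
      by (intro mult_right_mono) auto
    then show ?thesis using M(2)[of u] by simp
  qed
  txt \<open>With this radius a curve that leaves \<open>K\<close> is too long already when it first reaches the
    boundary of \<open>K\<close>.\<close>
  show thesis
  proof (rule that)
    show "m * r / M > 0" using m M r by simp
    fix y assume y: "y \<in> chart_dom c" "dist (chart_map c y) (chart_map c x) < m * r / M"
    have "F (x, push id c x (chart_map c y - chart_map c x)) \<le> m * r"
      using M(2)[of "chart_map c y - chart_map c x"] y(2) M(1) by (simp add: dist_norm field_simps)
    then have N_y: "N (chart_map c y - chart_map c x) \<le> (1 - \<epsilon>) * (m * r)"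
      unfolding N_def using assms by (intro mult_left_mono) auto
    show "ereal ((1 - \<epsilon>) * F (x, push id c x (chart_map c y - chart_map c x))) \<le> finsler_dist A F x y"
    proof (rule finsler_dist_greatest)
      fix a b \<gamma> assume ab: "a < b" and \<gamma>: "piecewise_C1_curve A a b \<gamma>" and ends: "\<gamma> a = x" "\<gamma> b = y"
      note lower = seminorm_le_integral_speed_piecewise[OF \<gamma> ab c(1), of K N M]
      have K_dom: "K \<subseteq> chart_dom c" by (auto simp: K_def)
      note lower = lower[OF K_dom N_le N_add N_scale _ N_bound]
      have "N (chart_map c y - chart_map c x) \<le> integral {a..b} (speed \<gamma>)"
      proof (rule exit_from_chart_ball[OF r(1,2) K_def piecewise_C1_curve_continuous[OF \<gamma> ab] ends(1)])
        assume "\<gamma> ` {a..b} \<subseteq> K"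
        then show ?thesis
          using lower(2)[of a b] ab M(1) ends by simp
      next
        fix \<tau> assume \<tau>: "\<tau> \<in> {a..b}" "\<gamma> ` {a..\<tau>} \<subseteq> K" "dist (chart_map c (\<gamma> \<tau>)) (chart_map c x) = r"
        have "(1 - \<epsilon>) * (m * r) \<le> N (chart_map c (\<gamma> \<tau>) - chart_map c x)"
          unfolding N_def using m(2)[of "chart_map c (\<gamma> \<tau>) - chart_map c x"] \<tau>(3) assms
          by (intro mult_left_mono) (auto simp: dist_norm)
        also have "\<dots> \<le> integral {a..\<tau>} (speed \<gamma>)"
          using lower(2)[of a \<tau>] \<tau> M(1) ends by simp
        also have "\<dots> \<le> integral {a..\<tau>} (speed \<gamma>) + integral {\<tau>..b} (speed \<gamma>)"
          using lower(1)[of \<tau> b] \<tau>(1) M(1) by simp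
        also have "\<dots> = integral {a..b} (speed \<gamma>)"
          using \<tau>(1) by (intro Henstock_Kurzweil_Integration.integral_combine
              speed_integrable_piecewise[OF \<gamma> ab]) auto
        finally show ?thesis using N_y by simp
      qed
      then show "ereal ((1 - \<epsilon>) * F (x, push id c x (chart_map c y - chart_map c x)))
          \<le> ereal (finsler_length A F a b \<gamma>)"
        by (simp add: finsler_length_def N_def)
    qed
  qed
qed

lemma finsler_dist_upper:
  assumes "0 < \<epsilon>"
  obtains \<delta> where "\<delta> > 0"
    "\<And>e. norm e < \<delta> \<Longrightarrow> finsler_dist A F x (chart_inv c (chart_map c x + e)) \<le>
       ereal ((1 + \<epsilon>) * F (x, push id c x e))"
proof -
  obtain r where r: "r > 0" "cball (chart_map c x) r \<subseteq> chart_map c ` chart_dom c"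
    "\<And>y e. y \<in> chart_dom c \<Longrightarrow> dist (chart_map c y) (chart_map c x) \<le> r \<Longrightarrow>
       \<bar>F (y, push id c y e) - F (x, push id c x e)\<bar> \<le> \<epsilon> * F (x, push id c x e)"
    by (rule F_push_locally_close[OF assms(1)]) blast
  show thesis
  proof (rule that[OF r(1)])
    fix e :: 'e assume e: "norm e < r"
    define line where "line t = chart_map c x + t *\<^sub>R e" for t :: real
    define \<gamma> where "\<gamma> = chart_inv c \<circ> line"
    have line: "line t \<in> cball (chart_map c x) r" if "t \<in> {0..1}" for t
    proof -
      have "\<bar>t\<bar> * norm e \<le> 1 * norm e"
        using that by (intro mult_right_mono) auto
      then show ?thesis
        using e by (simp add: line_def dist_norm)
    qed
    have \<gamma>_dom: "\<gamma> t \<in> chart_dom c" and line_eq: "chart_map c (\<gamma> t) = line t" if "t \<in> {0..1}" for t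
      using line[OF that] r(2) c(1) unfolding \<gamma>_def by auto
    have cont_line: "continuous_on {0..1} line"
      unfolding line_def by (intro continuous_intros)
    have cont: "continuous_on {0..1} \<gamma>"
      unfolding \<gamma>_def comp_def
      by (rule continuous_on_compose2[OF continuous_on_chart_inv[OF c(1)] cont_line]) (use line r(2) in blast)
    \<comment> \<open>A C1 curve has to be C1 in every chart it meets, so the segment, straight in
      \<open>c\<close>, is also differentiated in each other chart \<open>d\<close>.\<close>
    have deriv: "(chart_map d \<circ> \<gamma> has_vector_derivative coord_deriv id c d (\<gamma> t) e) (at t within {0..1})"
      if t: "t \<in> {0..1}" and d: "d \<in> A" "\<gamma> t \<in> chart_dom d" for t d
    proof -
      have "(line has_vector_derivative e) (at t within {0..1})"
        unfolding line_def by (auto intro!: derivative_eq_intros)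
      moreover have "(coord_map id c d has_derivative coord_deriv id c d (\<gamma> t)) (at (line t) within line ` {0..1})"
        using coord_map_has_derivative[OF C1_map_id c(1) d(1) \<gamma>_dom[OF t]] d(2)
        by (simp add: line_eq[OF t] has_derivative_at_withinI)
      ultimately have "(coord_map id c d \<circ> line has_vector_derivative coord_deriv id c d (\<gamma> t) e) (at t within {0..1})"
        by (rule vector_derivative_diff_chain_within)
      moreover have "coord_map id c d \<circ> line = chart_map d \<circ> \<gamma>"
        by (simp add: coord_map_def \<gamma>_def comp_assoc)
      ultimately show ?thesis by simp
    qed
    have C1: "C1_curve A 0 1 \<gamma>"
      unfolding C1_curve_def
    proof (intro conjI ballI cont)
      fix d assume d: "d \<in> A"
      have "continuous_on ({0..1} \<inter> \<gamma> -` chart_dom d) (\<lambda>t. coord_deriv id c d (\<gamma> t) e)"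
        by (rule continuous_on_coord_deriv[OF C1_map_id c(1) d])
          (use \<gamma>_dom in \<open>auto intro: continuous_on_subset[OF cont]\<close>)
      then show "\<exists>g'. continuous_on ({0..1} \<inter> \<gamma> -` chart_dom d) g' \<and>
          (\<forall>t\<in>{0..1} \<inter> \<gamma> -` chart_dom d.
            (chart_map d \<circ> \<gamma> has_vector_derivative g' t) (at t within {0..1}))"
        using deriv d by blast
    qed
    have vel: "vel \<gamma> {0..1} t = push id c (\<gamma> t) e" if t: "t \<in> {0..1}" for t
      using vel_eq_push[OF C1 zero_less_one t c(1) \<gamma>_dom[OF t]]
        vel_apply[of t 0 1 c \<gamma>, OF t zero_less_one c(1) \<gamma>_dom[OF t] deriv[OF t c(1) \<gamma>_dom[OF t]]]
        coord_deriv_id[OF c(1) \<gamma>_dom[OF t], of e] by simp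
    have "finsler_length A F 0 1 \<gamma> = integral {0..1} (\<lambda>t. F (\<gamma> t, vel \<gamma> {0..1} t))"
      unfolding finsler_length_def by (rule integral_speed[OF C1 zero_less_one])
    also have "\<dots> \<le> integral {0..1} (\<lambda>_::real. (1 + \<epsilon>) * F (x, push id c x e))"
    proof (rule integral_le)
      show "(\<lambda>t. F (\<gamma> t, vel \<gamma> {0..1} t)) integrable_on {0..1}"
        by (rule integrable_continuous_real[OF continuous_on_F_vel[OF C1 zero_less_one]])
      fix t :: real assume t: "t \<in> {0..1}"
      have "dist (chart_map c (\<gamma> t)) (chart_map c x) \<le> r"
        using line[OF t] line_eq[OF t] by (simp add: dist_commute)
      from r(3)[OF \<gamma>_dom[OF t] this, of e]
      show "F (\<gamma> t, vel \<gamma> {0..1} t) \<le> (1 + \<epsilon>) * F (x, push id c x e)"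
        unfolding vel[OF t] by (simp add: algebra_simps abs_le_iff)
    qed (rule integrable_const_ivl)
    also have "\<dots> = (1 + \<epsilon>) * F (x, push id c x e)"
      by simp
    finally have "finsler_length A F 0 1 \<gamma> \<le> (1 + \<epsilon>) * F (x, push id c x e)" .
    moreover have "piecewise_C1_curve A 0 1 \<gamma>"
      unfolding piecewise_C1_curve_def using C1
      by (intro exI[of _ 1] exI[of _ "real"]) simp
    moreover have "\<gamma> 0 = x" "\<gamma> 1 = chart_inv c (chart_map c x + e)"
      using c by (simp_all add: \<gamma>_def line_def)
    ultimately show "finsler_dist A F x (chart_inv c (chart_map c x + e)) \<le>
        ereal ((1 + \<epsilon>) * F (x, push id c x e))"
      using finsler_dist_le[of 0 1 \<gamma>] by (metis ereal_less_eq(3) order_trans zero_less_one)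
  qed
qed

end

section \<open>From distances back to the metric\<close>

text \<open>For the point \<open>y\<close> with coordinates
  \<open>chart_map c x + t *\<^sub>R e\<close> the two comparisons sandwich the distances:
  \<open>(1 - \<epsilon>) * N' (\<phi> t - \<phi> 0)\<close> is at most the distance of the images,
  hence at most \<open>(1 + \<epsilon>) * N (t *\<^sub>R e)\<close>. Dividing by \<open>t\<close>
  and letting \<open>t\<close> tend to 0 from the right turns the increment of \<phi> into the
  differential.\<close>

lemma F_differential_le:
  assumes f: "Ck_map 1 A f" and dist_le: "\<And>x y. finsler_dist A F (f x) (f y) \<le> finsler_dist A F x y"
    and v: "v \<in> tangent_space A x"
  shows "F (f x, differential A f x v) \<le> F (x, v)"
proof -
  obtain c where c: "c \<in> A" "x \<in> chart_dom c" by (rule chart_at)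
  obtain d where d: "d \<in> A" "f x \<in> chart_dom d" by (rule chart_at)
  define e where "e = v c"
  define N where "N u = F (x, push id c x u)" for u
  define N' where "N' u = F (f x, push id d (f x) u)" for u
  define \<phi> where "\<phi> t = coord_map f c d (chart_map c x + t *\<^sub>R e)" for t :: real
  define D where "D = coord_deriv f c d x e"
  have eqs: "F (x, v) = N e" "F (f x, differential A f x v) = N' D"
    using tangent_vector_eq_push[OF v c] differential_eq_push[OF f v c] push_eq_push_id[OF f c(1) d(1) c(2) d(2)]
    by (simp_all add: N_def N'_def D_def e_def)
  have \<phi>0: "\<phi> 0 = chart_map d (f x)"
    using c by (simp add: \<phi>_def coord_map_def)
  have "(\<phi> has_vector_derivative D) (at 0 within {0<..})"
  proof -
    define line where "line t = chart_map c x + t *\<^sub>R e" for t :: real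
    have "(line has_vector_derivative e) (at 0 within {0<..})"
      unfolding line_def by (auto intro!: derivative_eq_intros)
    moreover have "(coord_map f c d has_derivative coord_deriv f c d x) (at (line 0) within line ` {0<..})"
      using coord_map_has_derivative[OF f c(1) d(1) c(2) d(2)]
      by (simp add: line_def has_derivative_at_withinI)
    ultimately have "(coord_map f c d \<circ> line has_vector_derivative coord_deriv f c d x e) (at 0 within {0<..})"
      by (rule vector_derivative_diff_chain_within)
    then show ?thesis
      by (simp add: \<phi>_def[abs_def] D_def comp_def line_def)
  qed
  note \<phi>_deriv = this
  have "N' D * (1 - \<epsilon>) \<le> N e * (1 + \<epsilon>)" if \<epsilon>: "0 < \<epsilon>" "\<epsilon> < 1" for \<epsilon>
  proof -
    obtain \<delta>1 where \<delta>1: "\<delta>1 > 0"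
      "\<And>u. norm u < \<delta>1 \<Longrightarrow> finsler_dist A F x (chart_inv c (chart_map c x + u)) \<le> ereal ((1 + \<epsilon>) * N u)"
      unfolding N_def by (rule finsler_dist_upper[OF c \<epsilon>(1)]) blast
    obtain \<delta>2 where \<delta>2: "\<delta>2 > 0"
      "\<And>y. y \<in> chart_dom d \<Longrightarrow> dist (chart_map d y) (chart_map d (f x)) < \<delta>2 \<Longrightarrow>
         ereal ((1 - \<epsilon>) * N' (chart_map d y - chart_map d (f x))) \<le> finsler_dist A F (f x) y"
      unfolding N'_def by (rule finsler_dist_lower[OF d \<epsilon>]) blast
    define W where "W = chart_map c ` (chart_dom c \<inter> f -` chart_dom d)"
    have W: "open W" "chart_map c x \<in> W"
      using open_chart_image[OF c(1) open_vimage_C1[OF f open_chart_dom[OF d(1)]]] c(2) d(2)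
      by (simp_all add: W_def)
    have "((\<lambda>t. (\<phi> t - \<phi> 0) /\<^sub>R t) \<longlongrightarrow> D) (at_right 0)"
    proof -
      have "((\<lambda>t. (1 / norm t) *\<^sub>R (\<phi> t - (\<phi> 0 + t *\<^sub>R D))) \<longlongrightarrow> 0) (at_right 0)"
        using \<phi>_deriv by (simp add: has_vector_derivative_def has_derivative_within)
      from tendsto_add[OF this tendsto_const[of D]]
      have "((\<lambda>t. (1 / norm t) *\<^sub>R (\<phi> t - (\<phi> 0 + t *\<^sub>R D)) + D) \<longlongrightarrow> D) (at_right 0)"
        by simp
      moreover have "\<forall>\<^sub>F t in at_right 0. (1 / norm t) *\<^sub>R (\<phi> t - (\<phi> 0 + t *\<^sub>R D)) + D = (\<phi> t - \<phi> 0) /\<^sub>R t"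
        using eventually_at_right_less[of "0::real"]
        by eventually_elim (simp add: algebra_simps divide_inverse)
      ultimately show ?thesis
        by (rule Lim_transform_eventually)
    qed
    moreover have "isCont N' D"
      using continuous_on_F_push_point[OF d, of UNIV] unfolding N'_def
      by (simp add: continuous_on_eq_continuous_at)
    ultimately have lim: "((\<lambda>t. N' ((\<phi> t - \<phi> 0) /\<^sub>R t)) \<longlongrightarrow> N' D) (at_right 0)"
      by (intro isCont_tendsto_compose[of _ N'])
    have "((\<lambda>t. t *\<^sub>R e) \<longlongrightarrow> 0) (at_right 0)"
      by (auto intro!: tendsto_eq_intros)
    then have "\<forall>\<^sub>F t in at_right 0. norm (t *\<^sub>R e) < \<delta>1"
      using tendstoD[OF _ \<delta>1(1)] by fastforce
    moreover have "((\<lambda>t. chart_map c x + t *\<^sub>R e) \<longlongrightarrow> chart_map c x) (at_right 0)"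
      by (auto intro!: tendsto_eq_intros)
    then have "\<forall>\<^sub>F t in at_right 0. chart_map c x + t *\<^sub>R e \<in> W"
      by (rule topological_tendstoD[OF _ W])
    moreover have "(\<phi> \<longlongrightarrow> \<phi> 0) (at_right 0)"
      using has_vector_derivative_continuous[OF \<phi>_deriv] by (simp add: continuous_within)
    then have "\<forall>\<^sub>F t in at_right 0. dist (\<phi> t) (\<phi> 0) < \<delta>2"
      using \<delta>2(1) by (rule tendstoD)
    moreover have "\<forall>\<^sub>F t::real in at_right 0. t > 0"
      by (rule eventually_at_right_less)
    ultimately have "\<forall>\<^sub>F t in at_right 0. (1 - \<epsilon>) * N' ((\<phi> t - \<phi> 0) /\<^sub>R t) \<le> (1 + \<epsilon>) * N e"
    proof eventually_elim
      case (elim t)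
      define y where "y = chart_inv c (chart_map c x + t *\<^sub>R e)"
      have y: "y \<in> chart_dom c" "f y \<in> chart_dom d"
        using elim(2) c(1) by (auto simp: W_def y_def)
      have \<phi>t: "\<phi> t = chart_map d (f y)"
        by (simp add: \<phi>_def y_def coord_map_def)
      have "ereal ((1 - \<epsilon>) * N' (\<phi> t - \<phi> 0)) \<le> finsler_dist A F (f x) (f y)"
        using \<delta>2(2)[OF y(2)] elim(3) by (simp add: \<phi>t \<phi>0)
      also have "\<dots> \<le> finsler_dist A F x y"
        by (rule dist_le)
      also have "\<dots> \<le> ereal ((1 + \<epsilon>) * N (t *\<^sub>R e))"
        unfolding y_def by (rule \<delta>1(2)[OF elim(1)])
      finally have "(1 - \<epsilon>) * N' (\<phi> t - \<phi> 0) \<le> (1 + \<epsilon>) * N (t *\<^sub>R e)"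
        by simp
      moreover have "N (t *\<^sub>R e) = t * N e" "t * N' ((\<phi> t - \<phi> 0) /\<^sub>R t) = N' (\<phi> t - \<phi> 0)"
        using elim(4) F_push_scale[OF c, of t e] F_push_scale[OF d, of "inverse t" "\<phi> t - \<phi> 0"]
        by (simp_all add: N_def N'_def)
      ultimately have "t * ((1 - \<epsilon>) * N' ((\<phi> t - \<phi> 0) /\<^sub>R t)) \<le> t * ((1 + \<epsilon>) * N e)"
        by (metis mult.left_commute)
      then show ?case
        using elim(4) by (simp only: mult_le_cancel_left_pos)
    qed
    moreover have "((\<lambda>t. (1 - \<epsilon>) * N' ((\<phi> t - \<phi> 0) /\<^sub>R t)) \<longlongrightarrow> (1 - \<epsilon>) * N' D) (at_right 0)"
      by (intro tendsto_intros lim)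
    ultimately have "(1 - \<epsilon>) * N' D \<le> (1 + \<epsilon>) * N e"
      by (intro tendsto_upperbound) auto
    then show ?thesis
      by (simp add: mult.commute)
  qed
  note approx = this
  have nonneg: "0 \<le> N e"
    unfolding N_def by (rule F_nonneg[OF push_id_in_tangent_space[OF c]])
  have "N' D \<le> N e"
  proof (rule ccontr)
    assume less: "\<not> N' D \<le> N e"
    \<comment> \<open>With this choice the estimate would read
      \<open>N' D - N e \<le> (N' D - N e) / 2\<close>, which is impossible for a positive
      difference.\<close>
    define \<epsilon> where "\<epsilon> = (N' D - N e) / (2 * (N' D + N e))"
    have "0 < \<epsilon>" "\<epsilon> < 1" "\<epsilon> * (N' D + N e) = (N' D - N e) / 2"
      using less nonneg by (auto simp: \<epsilon>_def field_simps)
    with approx[of \<epsilon>] less show False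
      by (simp add: algebra_simps)
  qed
  then show ?thesis
    by (simp add: eqs)
qed

end

theorem theorem3p1:
  fixes A :: "('m::{t2_space,second_countable_topology}, 'e::{banach,heine_borel}) chart set"
    and k :: enat
    and F :: "'m \<times> ('m, 'e) tangent_vector \<Rightarrow> real"
    and f :: "'m \<Rightarrow> 'm"
  assumes "k \<ge> 1"
    and "differentiable_manifold k A"
    and "finsler_metric A F"
    and "diffeomorphism k A f"
  shows "(\<forall>x y. finsler_dist A F (f x) (f y) = finsler_dist A F x y) \<longleftrightarrow>
    (\<forall>(x, v)\<in>tangent_bundle A. F (f x, differential A f x v) = F (x, v))"
proof -
  interpret finsler_manifold A F
    using assms(1-3) Ck_on_mono unfolding differentiable_manifold_def
    by unfold_locales (simp_all only: differentiable_manifold_def, blast)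
  let ?g = "inv f"
  have "bij f" and f: "Ck_map 1 A f" and g: "Ck_map 1 A ?g"
    using assms(1,4) Ck_on_mono unfolding diffeomorphism_def Ck_map_def by blast+
  have gf: "?g \<circ> f = id" and fg: "f \<circ> ?g = id"
    using \<open>bij f\<close> by (simp_all add: bij_is_inj bij_is_surj[THEN surj_iff[THEN iffD1]])
  have gf': "?g (f x) = x" and fg': "f (?g x) = x" for x
    using gf fg by (metis comp_apply id_apply)+
  show ?thesis
  proof
    assume iso: "\<forall>x y. finsler_dist A F (f x) (f y) = finsler_dist A F x y"
    show "\<forall>(x, v)\<in>tangent_bundle A. F (f x, differential A f x v) = F (x, v)"
    proof clarify
      fix x v assume "(x, v) \<in> tangent_bundle A"
      then have v: "v \<in> tangent_space A x"
        by (simp add: tangent_bundle_def)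
      have "F (f x, differential A f x v) \<le> F (x, v)"
        using iso v by (intro F_differential_le[OF f]) auto
      \<comment> \<open>The inverse also preserves distances, and its differential at
        \<open>f x\<close> sends the image vector back to \<open>v\<close>; this gives the reverse
        inequality.\<close>
      moreover have "finsler_dist A F (?g y) (?g z) \<le> finsler_dist A F y z" for y z
        using iso fg' by (metis order_refl)
      from F_differential_le[OF g this differential_in_tangent_space[OF f v]]
      have "F (x, v) \<le> F (f x, differential A f x v)"
        using differential_left_inverse[OF f g gf v] by (simp add: gf')
      ultimately show "F (f x, differential A f x v) = F (x, v)"
        by simp
    qed
  next
    assume "\<forall>(x, v)\<in>tangent_bundle A. F (f x, differential A f x v) = F (x, v)"
    then have iso: "F (f x, differential A f x v) = F (x, v)" if "v \<in> tangent_space A x" for x v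
      using that by (auto simp: tangent_bundle_def)
    \<comment> \<open>The assumption is applied at \<open>?g y\<close> to the image of
      \<open>w\<close> under the differential of \<open>?g\<close>, which the differential of
      \<open>f\<close> maps back to \<open>w\<close>.\<close>
    have "F (?g y, differential A ?g y w) \<le> F (y, w)" if w: "w \<in> tangent_space A y" for y w
      using iso[OF differential_in_tangent_space[OF g w]] differential_left_inverse[OF g f fg w]
      by (simp add: fg')
    then have "finsler_dist A F (?g (f x)) (?g (f y)) \<le> finsler_dist A F (f x) (f y)" for x y
      by (rule finsler_dist_C1_map_le[OF g])
    moreover have "finsler_dist A F (f x) (f y) \<le> finsler_dist A F x y" for x y
      using iso by (intro finsler_dist_C1_map_le[OF f]) simp
    ultimately show "\<forall>x y. finsler_dist A F (f x) (f y) = finsler_dist A F x y"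
      by (simp add: gf' antisym)
  qed
qed

end
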